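(* Let $f$ be a complex-valued function on $\mathbb{R}_+=(0,\infty)$ which is represented by the integral $$f(x)=\int_{-\pi}^{\pi}\sin(x\sinh(u))\,\varphi(u)\,du,\qquad x>0,$$ where $\varphi(u)=\psi(u)\cosh(u)$ and $\psi$ is a $2\pi$-periodic function satisfying the Lipschitz condition on $[-\pi,\pi]$, i.e. there is an absolute constant $C>0$ with $$|\psi(u)-\psi(v)|\le C|u-v|\qquad\text{for all }u,v\in[-\pi,\pi].$$ Then for all $x>0$ $$f(x)=\frac{2}{x\pi^2}\sum_{n=1}^\infty n\sinh(\pi n)\,K_c(x,in,\pi)\int_0^\infty K_{in}(y)f(y)\,dy .$$ Further, if $f$ can be expanded in terms of the series $$f(x)=\sum_{m=1}^\infty a_m K_{im}(x),\qquad x>0,$$ for an arbitrary sequence $\{a_m\}_{m\in\mathbb{N}}$ satisfying $\sum_{m=1}^\infty|a_m|e^{-\pi m/2}<\infty$, then for all $x>0$ $$f(x)=\frac{2}{\pi^2}\sum_{n=1}^\infty n\sinh(\pi n)\,K_{in}(x)\int_0^\infty K_c(y,in,\pi)f(y)\,\frac{dy}{y}.$$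
   Context: $\mathbb{N}=\{1,2,\dots\}$ and $i$ is the imaginary unit. $K_\nu$ is the modified Bessel (Macdonald) function, $K_\nu(x)=\int_0^\infty e^{-x\cosh u}\cosh(\nu u)\,du$ for $x>0$, $\nu\in\mathbb{C}$; thus $K_{in}(x)=\int_0^\infty e^{-x\cosh u}\cos(nu)\,du$. The function $K_c$ is defined by $K_c(x,\nu,w)=\frac{1}{\cos(\pi\nu/2)}\int_0^w\cos(x\sinh u)\cosh(\nu u)\,du$; thus $K_c(x,in,\pi)=\frac{1}{\cosh(\pi n/2)}\int_0^\pi\cos(x\sinh u)\cos(nu)\,du$. *)

theory Defs
  imports "HOL-Analysis.Analysis"
begin

text \<open>Modified Bessel function of the second kind (Macdonald function), for \<open>x > 0\<close>.\<close>

definition macdonald_K :: "complex \<Rightarrow> real \<Rightarrow> complex" where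
  "macdonald_K \<nu> x =
     (LBINT u:{0<..}. of_real (exp (- x * cosh u)) * cosh (\<nu> * of_real u))"

definition Kc :: "real \<Rightarrow> complex \<Rightarrow> real \<Rightarrow> complex" where
  "Kc x \<nu> w =
     1 / cos (of_real pi * \<nu> / 2)
       * (LBINT u=0..w. of_real (cos (x * sinh u)) * cosh (\<nu> * of_real u))"

end

theory Submission
  imports Defs "HOL-Complex_Analysis.Complex_Analysis" "HOL-Probability.Sinc_Integral" "HOL-Real_Asymp.Real_Asymp"
begin

text \<open>
  Both expansions rest on the sine transform of the Macdonald function,
  \<open>\<integral>\<^sub>0\<^sup>\<infinity> K\<^bsub>i n\<^esub>(y) sin (y sinh u) dy = \<pi> sin (n u) / (2 sinh (\<pi> n / 2) cosh u)\<close> (\<open>besselK_sine_transform\<close>),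
  which reduces by Fubini's theorem to the Fourier integral of \<open>tanh (t + u) - tanh (t - u)\<close>; the latter
  is evaluated by residues (\<open>fourier_tanh_diff\<close>). An integration by parts shows that \<open>K\<^sub>c(x, i n, \<pi>)\<close> equals
  \<open>x / (n cosh (\<pi> n / 2))\<close> times the \<open>n\<close>-th sine coefficient on \<open>[0, \<pi>]\<close> of \<open>g\<^sub>x(u) = sin (x sinh u) cosh u\<close>.

  In the first expansion, \<open>f x\<close> is the inner product of \<open>g\<^sub>x\<close> with \<open>h u = \<psi> u - \<psi> (-u)\<close> over \<open>[0, \<pi>]\<close>. By the sine
  transform, \<open>\<integral>\<^sub>0\<^sup>\<infinity> K\<^bsub>i n\<^esub> f\<close> is a multiple of the \<open>n\<close>-th sine coefficient of \<open>h\<close>, and with all constants collected the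
  series is Parseval's identity for \<open>g\<^sub>x\<close> and \<open>h\<close> (\<open>sine_parseval\<close>). The Lipschitz condition and periodicity
  bound \<open>h\<close> by a multiple of \<open>sin\<close>, which allows uniform approximation by sine polynomials.

  In the second expansion, the sine transform yields the orthogonality relation
  \<open>\<integral>\<^sub>0\<^sup>\<infinity> K\<^sub>c(y, i n, \<pi>) K\<^bsub>i m\<^esub>(y) dy / y = \<pi>\<^sup>2 / (2 n sinh (\<pi> n))\<close> for \<open>m = n\<close>, and 0 otherwise, so the integral in
  question only picks out \<open>a\<^sub>n\<close>. To integrate the series term by term one needs
  \<open>\<integral>\<^sub>0\<^sup>\<infinity> \<bar>K\<^sub>c(y, i n, \<pi>) K\<^bsub>i m\<^esub>(y)\<bar> dy / y = O(e\<^bsup>-\<pi>m/2\<^esup>)\<close>. This holds because \<open>K\<^sub>c(y, i n, \<pi>) / y\<close> is square-integrable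
  and the \<open>L\<^sup>2\<close> norm of \<open>K\<^bsub>i m\<^esub>\<close> has exactly the required decay (\<open>besselK_square_integral\<close>).
\<close>

section \<open>A Fourier integral by residues\<close>

lemma norm_cosh_power2: "(norm (cosh z))\<^sup>2 = (cos (Im z))\<^sup>2 + (sinh (Re z))\<^sup>2" for z :: complex
proof -
  have "exp (Re z) - inverse (exp (Re z)) = 2 * sinh (Re z)"
    by (simp add: sinh_field_def exp_minus)
  then show ?thesis by (simp add: cosh_conv_cos norm_cos_squared power_mult_distrib)
qed

lemma cosh_complex_eq_0D:
  fixes z :: complex
  assumes "cosh z = 0" "- (pi/2) < Im z" "Im z < 3 * pi / 2"
  shows "z = \<i> * of_real (pi/2)"
proof -
  have "(cos (Im z))\<^sup>2 + (sinh (Re z))\<^sup>2 = 0"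
    using norm_cosh_power2[of z] assms(1) by simp
  then have c: "cos (Im z) = 0" and "sinh (Re z) = 0"
    by (simp_all add: sum_power2_eq_zero_iff)
  then have re: "Re z = 0" by simp
  have im: "Im z = pi/2"
  proof (rule ccontr)
    assume n: "Im z \<noteq> pi/2"
    show False
    proof (cases "Im z < pi/2")
      case True then show False using cos_gt_zero_pi[of "Im z"] assms(2) c by simp
    next
      case False
      then have "cos (Im z - pi) > 0" using n assms(3) by (intro cos_gt_zero_pi) auto
      then show False using c by (simp add: cos_diff)
    qed
  qed
  show ?thesis using re im by (simp add: complex_eq_iff)
qed

lemma holomorphic_on_sinh_shift: "(\<lambda>z. sinh (z + u)) holomorphic_on A"
  and holomorphic_on_cosh_shift: "(\<lambda>z. cosh (z + u)) holomorphic_on A" for u :: complex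
  unfolding sinh_field_def cosh_field_def by (intro holomorphic_intros; simp)+

text \<open>In the strip \<open>-\<pi>/2 < Im (z + u) < 3\<pi>/2\<close> the function \<open>tanh (z + u)\<close> has a single pole, with
  residue 1. The strip contains the rectangle, and the pole lies inside.\<close>

lemma contour_integral_rectpath_tanh:
  fixes u :: complex and \<omega> R :: real
  assumes u: "\<bar>Im u\<bar> < pi/2" and R: "\<bar>Re u\<bar> < R"
  defines "F \<equiv> (\<lambda>z. exp (\<i> * \<omega> * z) * tanh (z + u))"
  shows "contour_integral (rectpath (of_real (-R)) (Complex R pi)) F
         = 2 * pi * \<i> * exp (\<i> * \<omega> * (\<i> * (pi/2) - u))"
    and "F holomorphic_on {z. -(pi/2) < Im (z+u) \<and> Im (z+u) < 3*pi/2} - {\<i> * (pi/2) - u}"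
proof -
  define S where "S = {z. -(pi/2) < Im (z+u) \<and> Im (z+u) < 3*pi/2}"
  define p where "p = \<i> * (pi/2) - u"
  have R0: "R > 0" using R by linarith
  have S_alt: "S = {z. Im z > -(pi/2) - Im u} \<inter> {z. Im z < 3*pi/2 - Im u}"
    unfolding S_def by auto
  have op: "open S" unfolding S_alt
    by (intro open_Int open_halfspace_Im_gt open_halfspace_Im_lt)
  have cvx: "convex S" unfolding S_alt
    by (intro convex_Int convex_halfspace_Im_gt convex_halfspace_Im_lt)
  have nz: "cosh (z + u) \<noteq> 0" if "z \<in> S - {p}" for z
  proof
    assume "cosh (z + u) = 0"
    then have "z + u = \<i> * of_real (pi/2)"
      using that by (intro cosh_complex_eq_0D) (auto simp: S_def)
    then have "z = p" by (simp add: p_def algebra_simps)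
    then show False using that by auto
  qed
  have F_alt: "F = (\<lambda>z. (exp (\<i> * \<omega> * z) * sinh (z + u)) / cosh (z + u))"
    by (simp add: F_def tanh_def)
  have holo: "F holomorphic_on S - {p}" unfolding F_alt
    using nz by (auto intro!: holomorphic_intros holomorphic_on_sinh_shift holomorphic_on_cosh_shift)
  then show "F holomorphic_on {z. -(pi/2) < Im (z+u) \<and> Im (z+u) < 3*pi/2} - {\<i> * (pi/2) - u}"
    by (simp add: S_def p_def)
  have sub: "cbox (of_real (-R)) (Complex R pi) \<subseteq> S"
    using u by (auto simp: in_cbox_complex_iff S_def)
  have pin: "p \<in> box (of_real (-R)) (Complex R pi)"
    using u R by (auto simp: in_box_complex_iff p_def)
  have pS: "p \<in> S" using pin sub box_subset_cbox by blast
  have ch: "cosh (\<i> * (pi/2)) = 0" "sinh (\<i> * (pi/2)) = \<i>"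
    by (simp_all add: cosh_conv_cos sinh_conv_sin flip: cos_of_real sin_of_real mult.assoc)
  have res: "residue F p = exp (\<i> * \<omega> * p)"
  proof -
    have "residue F p = (exp (\<i> * \<omega> * p) * sinh (p + u)) / sinh (p + u)"
      unfolding F_alt
    proof (rule residue_simple_pole_deriv[where s = UNIV])
      show "((\<lambda>z. cosh (z + u)) has_field_derivative sinh (p + u)) (at p)"
        by (auto intro!: derivative_eq_intros)
    qed (use ch in \<open>auto intro!: holomorphic_intros holomorphic_on_sinh_shift holomorphic_on_cosh_shift simp: p_def\<close>)
    also have "\<dots> = exp (\<i> * \<omega> * p)"
    proof -
      have "sinh (p + u) = \<i>" using ch(2) by (simp add: p_def)
      then show ?thesis
        by (simp only: nonzero_mult_div_cancel_right complex_i_not_zero not_False_eq_True)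
    qed
    finally show ?thesis .
  qed
  have "contour_integral (rectpath (of_real (-R)) (Complex R pi)) F
      = 2 * pi * \<i> * (\<Sum>q\<in>{p}. winding_number (rectpath (of_real (-R)) (Complex R pi)) q * residue F q)"
  proof (rule Residue_theorem[OF op convex_connected[OF cvx] _ holo])
    have "path_image (rectpath (of_real (-R)) (Complex R pi)) =
        cbox (of_real (-R)) (Complex R pi) - box (of_real (-R)) (Complex R pi)"
      using R0 by (intro path_image_rectpath_cbox_minus_box) auto
    then show "path_image (rectpath (of_real (-R)) (Complex R pi)) \<subseteq> S - {p}"
      using sub pin by auto
    show "\<forall>z. z \<notin> S \<longrightarrow> winding_number (rectpath (complex_of_real (- R)) (Complex R pi)) z = 0"
      using R0 sub by (auto intro!: winding_number_rectpath_outside)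
  qed auto
  also have "\<dots> = 2 * pi * \<i> * exp (\<i> * \<omega> * p)"
    using winding_number_rectpath[OF pin] res by simp
  finally show "contour_integral (rectpath (of_real (-R)) (Complex R pi)) F
         = 2 * pi * \<i> * exp (\<i> * \<omega> * (\<i> * (pi/2) - u))"
    by (simp add: p_def)
qed

lemma contour_integral_rectpath_eq:
  fixes f :: "complex \<Rightarrow> complex"
  assumes R: "R > 0" and h: "h > 0"
    and c: "continuous_on (path_image (rectpath (of_real (-R)) (Complex R h))) f"
  shows "contour_integral (rectpath (of_real (-R)) (Complex R h)) f
       = integral {-R..R} (\<lambda>x. f (of_real x)) - integral {-R..R} (\<lambda>x. f (of_real x + \<i> * h))
         + contour_integral (linepath (of_real R) (Complex R h)) f
         - contour_integral (linepath (of_real (-R)) (Complex (-R) h)) f"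
proof -
  let ?a = "complex_of_real (-R)" and ?b = "complex_of_real R"
  let ?c = "Complex R h" and ?d = "Complex (-R) h"
  have rp: "rectpath ?a ?c = linepath ?a ?b +++ linepath ?b ?c +++ linepath ?c ?d +++ linepath ?d ?a"
    by (simp add: rectpath_def Let_def Complex_eq)
  have pi: "path_image (rectpath ?a ?c) = closed_segment ?a ?b \<union> closed_segment ?b ?c
      \<union> closed_segment ?c ?d \<union> closed_segment ?d ?a"
    unfolding rp by (simp add: path_image_join Un_assoc)
  have i: "f contour_integrable_on linepath x y"
    if "closed_segment x y \<subseteq> path_image (rectpath ?a ?c)" for x y
    using that by (intro contour_integrable_continuous_linepath continuous_on_subset[OF c])
  have "contour_integral (rectpath ?a ?c) f = contour_integral (linepath ?a ?b) f
     + contour_integral (linepath ?b ?c) f + contour_integral (linepath ?c ?d) f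
     + contour_integral (linepath ?d ?a) f"
  proof -
    have "f contour_integrable_on linepath ?a ?b" "f contour_integrable_on linepath ?b ?c"
      "f contour_integrable_on linepath ?c ?d" "f contour_integrable_on linepath ?d ?a"
      by (rule i, unfold pi, blast)+
    then show ?thesis unfolding rp by (simp add: contour_integrable_join del: of_real_minus)
  qed
  moreover have "contour_integral (linepath ?d ?a) f = - contour_integral (linepath ?a ?d) f"
    using contour_integral_reversepath[of "linepath ?a ?d" f] by simp
  moreover have "contour_integral (linepath ?c ?d) f = - contour_integral (linepath ?d ?c) f"
    using contour_integral_reversepath[of "linepath ?d ?c" f] by simp
  moreover have "contour_integral (linepath ?d ?c) f
      = contour_integral (linepath ?a ?b) (\<lambda>z. f (z + \<i> * h))"
    unfolding contour_integral_integral
    by (intro integral_cong) (simp add: linepath_def Complex_eq algebra_simps scaleR_conv_of_real)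
  moreover have "contour_integral (linepath ?a ?b) g = integral {-R..R} (\<lambda>x. g (of_real x))" for g
    using contour_integral_linepath_Reals_eq[of ?a ?b g] R by simp
  ultimately show ?thesis by simp
qed

lemma tanh_add_i_pi: "tanh (z + \<i> * pi) = tanh z" for z :: complex
proof -
  have "exp (z + \<i> * pi) = - exp z"
    by (simp add: exp_add)
  moreover from this have "exp (- (z + \<i> * pi)) = - exp (-z)"
    unfolding exp_minus by simp
  ultimately have "sinh (z + \<i> * pi) = - sinh z" "cosh (z + \<i> * pi) = - cosh z"
    unfolding sinh_field_def cosh_field_def by (simp_all add: field_simps)
  then show ?thesis by (simp add: tanh_def)
qed

lemma tanh_diff_eq:
  fixes z u :: complex
  assumes "cosh (z + u) \<noteq> 0" "cosh (z - u) \<noteq> 0"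
  shows "tanh (z + u) - tanh (z - u) = sinh (2 * u) / (cosh (z + u) * cosh (z - u))"
proof -
  have "sinh (2 * u) = sinh ((z + u) - (z - u))" by simp
  also have "\<dots> = sinh (z + u) * cosh (z - u) - cosh (z + u) * sinh (z - u)"
    by (rule sinh_diff)
  finally show ?thesis using assms by (simp add: tanh_def field_simps)
qed

lemma cosh_add_times_cosh_diff: "cosh (x + y) * cosh (x - y) = (cosh x)\<^sup>2 + (sinh y)\<^sup>2" for x y :: real
proof -
  have "cosh (x + y) * cosh (x - y) = (cosh x)\<^sup>2 * ((cosh y)\<^sup>2 - (sinh y)\<^sup>2) + (sinh y)\<^sup>2 * ((cosh x)\<^sup>2 - (sinh x)\<^sup>2)"
    by (simp add: cosh_add cosh_diff algebra_simps power2_eq_square)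
  then show ?thesis by (simp add: cosh_square_eq)
qed

lemma cosh_real_ge: "1 + x\<^sup>2 \<le> (cosh x)\<^sup>2" for x :: real
proof -
  have "\<bar>x\<bar> \<le> \<bar>sinh x\<bar>"
    using real_le_abs_sinh[of x] by (simp add: sinh_field_def exp_minus)
  then have "x\<^sup>2 \<le> (sinh x)\<^sup>2" by (simp add: abs_le_square_iff)
  then show ?thesis by (simp add: cosh_square_eq)
qed

lemma integrable_inverse_1_plus_square': "integrable lborel (\<lambda>x::real. 1 / (1 + x\<^sup>2))"
  using integrable_inverse_1_plus_square by (simp add: set_integrable_def einterval_def inverse_eq_divide)

text \<open>The integral is taken along the boundary of the rectangle with vertices \<open>\<plusminus>R\<close> and \<open>\<plusminus>R + i\<pi>\<close>. Since
  \<open>tanh\<close> has period \<open>i\<pi>\<close>, the upper side contributes \<open>-e\<^bsup>-\<pi>\<omega>\<^esup>\<close> times the lower one; the vertical sides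
  vanish as \<open>R\<close> tends to infinity. Complex values of \<open>u\<close> are allowed because \<open>u = i\<pi>/4\<close> is needed
  for the Fourier transform of \<open>1 / cosh\<close>.\<close>

lemma fourier_tanh_diff:
  fixes u :: complex and \<omega> :: real
  assumes u: "\<bar>Im u\<bar> < pi/2" and w: "\<omega> > 0"
  defines "G \<equiv> (\<lambda>t::real. exp (\<i> * \<omega> * t) * (tanh (t + u) - tanh (t - u)))"
  shows "integrable lborel G"
    and "integral\<^sup>L lborel G = 2 * pi * sin (\<omega> * u) / of_real (sinh (pi * \<omega> / 2))"
proof -
  define H where "H = (\<lambda>z. exp (\<i> * \<omega> * z) * (tanh (z + u) - tanh (z - u)))"
  define F1 where "F1 = (\<lambda>z. exp (\<i> * \<omega> * z) * tanh (z + u))"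
  define F2 where "F2 = (\<lambda>z. exp (\<i> * \<omega> * z) * tanh (z + (-u)))"
  have HF: "H = (\<lambda>z. F1 z - F2 z)" by (simp add: H_def F1_def F2_def algebra_simps fun_eq_iff)
  have GH: "G t = H (of_real t)" for t by (simp add: G_def H_def)
  define a where "a = Re u"
  have cpos: "cos (Im u) > 0" using u by (intro cos_gt_zero_pi) auto
  \<comment> \<open>a lower bound for cosh on horizontal lines; it makes \<open>G\<close> integrable and shows that no pole is real\<close>
  have cb: "norm (cosh (t + v)) \<ge> cos (Im u) * cosh (t + Re v)" 
    if "Im v = Im u \<or> Im v = - Im u" for t :: real and v :: complex
  proof -
    have "(cos (Im u) * cosh (t + Re v))\<^sup>2 \<le> (norm (cosh (t + v)))\<^sup>2"
    proof -
      have "(cos (Im u))\<^sup>2 \<le> 1" by (simp add: abs_square_le_1)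
      then have "(cos (Im u))\<^sup>2 * (sinh (t + Re v))\<^sup>2 \<le> 1 * (sinh (t + Re v))\<^sup>2"
        by (intro mult_right_mono) auto
      moreover have "(cos (Im v))\<^sup>2 = (cos (Im u))\<^sup>2" using that by auto
      ultimately show ?thesis
        by (simp add: norm_cosh_power2 power_mult_distrib cosh_square_eq algebra_simps)
    qed
    then show ?thesis by (rule power2_le_imp_le) simp
  qed
  have nz: "cosh (of_real t + u) \<noteq> 0" "cosh (of_real t - u) \<noteq> 0" for t :: real
  proof -
    have "cos (Im u) * cosh (t + Re u) > 0" "cos (Im u) * cosh (t + Re (-u)) > 0" using cpos by simp_all
    then have "norm (cosh (t + u)) > 0" "norm (cosh (t + (-u))) > 0"
      using cb[of u t] cb[of "-u" t] by auto
    then show "cosh (of_real t + u) \<noteq> 0" "cosh (of_real t - u) \<noteq> 0" by auto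
  qed
  have Gb: "norm (G t) \<le> norm (sinh (2 * u)) / (cos (Im u))\<^sup>2 * (1 / (1 + t\<^sup>2))" for t
  proof -
    note ct = cosh_add_times_cosh_diff[of t a]
    have "(cos (Im u))\<^sup>2 * (1 + t\<^sup>2) \<le> (cos (Im u))\<^sup>2 * (cosh (t + a) * cosh (t - a))"
      unfolding ct using cosh_real_ge[of t] by (intro mult_left_mono) (auto intro: add_increasing2)
    also have "\<dots> = (cos (Im u) * cosh (t + a)) * (cos (Im u) * cosh (t - a))"
      by (simp add: power2_eq_square)
    also have "\<dots> \<le> norm (cosh (t + u)) * norm (cosh (t - u))"
      using cb[of u t] cb[of "-u" t] cpos by (intro mult_mono) (auto simp: a_def)
    finally have le: "(cos (Im u))\<^sup>2 * (1 + t\<^sup>2) \<le> norm (cosh (t + u)) * norm (cosh (t - u))" .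
    have p: "0 < (cos (Im u))\<^sup>2 * (1 + t\<^sup>2)"
      using cpos by (intro mult_pos_pos) (auto intro: add_pos_nonneg)
    have "norm (G t) = norm (sinh (2 * u)) / (norm (cosh (t + u)) * norm (cosh (t - u)))"
      unfolding G_def tanh_diff_eq[OF nz] by (simp add: norm_mult norm_divide)
    also have "\<dots> \<le> norm (sinh (2 * u)) / ((cos (Im u))\<^sup>2 * (1 + t\<^sup>2))"
      using le p order.strict_trans2[OF p le] by (intro divide_left_mono[OF le] mult_pos_pos[OF _ p]) simp_all
    finally show ?thesis by simp
  qed
  have contG: "continuous_on UNIV G"
  proof -
    have "continuous_on UNIV (\<lambda>t::real. sinh (of_real t + v))" "continuous_on UNIV (\<lambda>t::real. cosh (of_real t + v))"
      for v :: complex unfolding sinh_field_def cosh_field_def by (intro continuous_intros; simp)+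
    from this[of u] this[of "-u"] show ?thesis
      unfolding G_def tanh_def using nz by (intro continuous_intros) auto
  qed
  then have mG: "G \<in> borel_measurable lborel" by (simp add: borel_measurable_continuous_onI)
  show int: "integrable lborel G"
    by (rule Bochner_Integration.integrable_bound[OF
          integrable_mult_right[OF integrable_inverse_1_plus_square', of "norm (sinh (2 * u)) / (cos (Im u))\<^sup>2"]])
      (use mG Gb in \<open>auto intro!: AE_I2 order_trans[OF Gb] simp: abs_mult\<close>)
  \<comment> \<open>the vertical side at abscissa R, directed upwards\<close>
  define V where "V = (\<lambda>R::real. contour_integral (linepath (of_real R) (Complex R pi)) H)"
  define q where "q = exp (- pi * \<omega>)"
  define c where "c = 2 * pi * \<i> * exp (\<i> * \<omega> * (\<i> * (pi/2) - u)) - 2 * pi * \<i> * exp (\<i> * \<omega> * (\<i> * (pi/2) + u))"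
  have holH: "H holomorphic_on {z. 0 \<le> Im z \<and> Im z \<le> pi} - {\<i> * (pi/2) - u, \<i> * (pi/2) + u}"
    and rectH: "R > \<bar>a\<bar> \<Longrightarrow> contour_integral (rectpath (of_real (-R)) (Complex R pi)) H = c" for R
  proof -
    have h1: "F1 holomorphic_on {z. -(pi/2) < Im (z+u) \<and> Im (z+u) < 3*pi/2} - {\<i> * (pi/2) - u}"
      unfolding F1_def using contour_integral_rectpath_tanh(2)[of u "\<bar>Re u\<bar> + 1" \<omega>] u by simp
    have h2: "F2 holomorphic_on {z. -(pi/2) < Im (z+(-u)) \<and> Im (z+(-u)) < 3*pi/2} - {\<i> * (pi/2) - (-u)}"
      unfolding F2_def using contour_integral_rectpath_tanh(2)[of "-u" "\<bar>Re u\<bar> + 1" \<omega>] u by simp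
    let ?S = "{z. 0 \<le> Im z \<and> Im z \<le> pi} - {\<i> * (pi/2) - u, \<i> * (pi/2) + u}"
    have h1': "F1 holomorphic_on ?S" and h2': "F2 holomorphic_on ?S"
      by (rule holomorphic_on_subset[OF h1] holomorphic_on_subset[OF h2]; use u in force)+
    then show "H holomorphic_on ?S" unfolding HF by (intro holomorphic_intros)
    assume R: "R > \<bar>a\<bar>"
    let ?r = "rectpath (of_real (-R)) (Complex R pi)"
    have "path_image ?r = cbox (of_real (-R)) (Complex R pi) - box (of_real (-R)) (Complex R pi)"
      using R by (intro path_image_rectpath_cbox_minus_box) auto
    then have "path_image ?r \<subseteq> ?S"
      using u R by (auto simp: in_cbox_complex_iff in_box_complex_iff a_def)
    then have sub: "path_image ?r \<subseteq> {z. -(pi/2) < Im (z+u) \<and> Im (z+u) < 3*pi/2} - {\<i> * (pi/2) - u}"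
      "path_image ?r \<subseteq> {z. -(pi/2) < Im (z+(-u)) \<and> Im (z+(-u)) < 3*pi/2} - {\<i> * (pi/2) - (-u)}"
      using u by (force dest: subsetD)+
    have op: "open ({z. -(pi/2) < Im (z+v) \<and> Im (z+v) < 3*pi/2} - {w})" for v w
      by (intro open_Diff open_Collect_conj open_Collect_less continuous_intros) auto
    have "F1 contour_integrable_on ?r" "F2 contour_integrable_on ?r"
      by (rule contour_integrable_holomorphic_simple[OF h1 op _ sub(1)]
               contour_integrable_holomorphic_simple[OF h2 op _ sub(2)]; simp)+
    then have "contour_integral ?r H = contour_integral ?r F1 - contour_integral ?r F2"
      unfolding HF by (rule contour_integral_diff)
    also have "contour_integral ?r F1 = 2 * pi * \<i> * exp (\<i> * \<omega> * (\<i> * (pi/2) - u))"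
      unfolding F1_def using u R by (intro contour_integral_rectpath_tanh(1)) (auto simp: a_def)
    also have "contour_integral ?r F2 = 2 * pi * \<i> * exp (\<i> * \<omega> * (\<i> * (pi/2) - (-u)))"
      unfolding F2_def using u R by (intro contour_integral_rectpath_tanh(1)) (auto simp: a_def)
    finally show "contour_integral ?r H = c" by (simp add: c_def)
  qed
  have rectH2: "c = (1 - q) * integral {-R..R} G + V R - V (-R)" if R: "R > \<bar>a\<bar>" for R
  proof -
    let ?r = "rectpath (of_real (-R)) (Complex R pi)"
    have "path_image ?r = cbox (of_real (-R)) (Complex R pi) - box (of_real (-R)) (Complex R pi)"
      using R by (intro path_image_rectpath_cbox_minus_box) auto
    then have "path_image ?r \<subseteq> {z. 0 \<le> Im z \<and> Im z \<le> pi} - {\<i> * (pi/2) - u, \<i> * (pi/2) + u}"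
      using u R by (auto simp: in_cbox_complex_iff in_box_complex_iff a_def)
    then have "continuous_on (path_image ?r) H"
      using holH holomorphic_on_imp_continuous_on continuous_on_subset by blast
    from contour_integral_rectpath_eq[OF _ _ this]
    have "c = integral {-R..R} (\<lambda>x. H (of_real x)) - integral {-R..R} (\<lambda>x. H (of_real x + \<i> * pi)) + V R - V (-R)"
      using R rectH[OF R] by (simp add: V_def)
    moreover have "H (of_real x + \<i> * pi) = q * G x" for x
    proof -
      have "tanh (of_real x + \<i> * pi + u) = tanh (of_real x + u)" "tanh (of_real x + \<i> * pi - u) = tanh (of_real x - u)"
        using tanh_add_i_pi[of "of_real x + u"] tanh_add_i_pi[of "of_real x - u"] by (simp_all add: algebra_simps)
      moreover have "exp (\<i> * \<omega> * (of_real x + \<i> * pi)) = of_real q * exp (\<i> * \<omega> * of_real x)"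
        by (simp add: q_def algebra_simps flip: exp_add exp_of_real)
      ultimately show ?thesis by (simp add: H_def G_def)
    qed
    moreover have "integral {-R..R} (\<lambda>x. of_real q * G x) = of_real q * integral {-R..R} G"
      by (rule integral_mult_right)
    moreover have "(\<lambda>x. H (of_real x)) = G" by (simp add: GH fun_eq_iff)
    ultimately show ?thesis by (simp add: algebra_simps)
  qed
  have Vb: "norm (V R) \<le> norm (sinh (2 * u)) / (sinh (\<bar>R\<bar> - \<bar>a\<bar>))\<^sup>2 * pi" if R: "\<bar>R\<bar> > \<bar>a\<bar>" for R
  proof -
    have seg: "z \<in> closed_segment (of_real R) (Complex R pi) \<Longrightarrow> Re z = R \<and> 0 \<le> Im z \<and> Im z \<le> pi" for z
      by (auto simp: closed_segment_same_Re closed_segment_eq_real_ivl)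
    have "closed_segment (of_real R) (Complex R pi) \<subseteq> {z. 0 \<le> Im z \<and> Im z \<le> pi} - {\<i> * (pi/2) - u, \<i> * (pi/2) + u}"
      using R by (auto dest!: seg simp: a_def)
    then have "H contour_integrable_on (linepath (of_real R) (Complex R pi))"
      by (intro contour_integrable_continuous_linepath holomorphic_on_imp_continuous_on holomorphic_on_subset[OF holH])
    then have "norm (V R) \<le> norm (sinh (2 * u)) / (sinh (\<bar>R\<bar> - \<bar>a\<bar>))\<^sup>2 * norm (Complex R pi - of_real R)"
      unfolding V_def
    proof (rule contour_integral_bound_linepath)
      fix z assume z: "z \<in> closed_segment (of_real R) (Complex R pi)"
      have s: "norm (cosh (z + v)) \<ge> sinh (\<bar>R\<bar> - \<bar>a\<bar>)" if "\<bar>Re v\<bar> = \<bar>a\<bar>" for v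
      proof -
        have "sinh (\<bar>R\<bar> - \<bar>a\<bar>) \<le> sinh \<bar>R + Re v\<bar>"
          unfolding sinh_real_le_iff using that by linarith
        also have "\<dots> = \<bar>sinh (R + Re v)\<bar>" using sinh_minus[of "R + Re v"] by (cases "R + Re v \<ge> 0") auto
        also have "\<dots> \<le> norm (cosh (z + v))"
          using norm_cosh_power2[of "z + v"] seg[OF z] by (intro abs_le_square_iff[THEN iffD2, of _ "norm _", simplified]) simp
        finally show ?thesis .
      qed
      have sp: "sinh (\<bar>R\<bar> - \<bar>a\<bar>) > 0" using R by simp
      have s12: "norm (cosh (z + u)) \<ge> sinh (\<bar>R\<bar> - \<bar>a\<bar>)" "norm (cosh (z - u)) \<ge> sinh (\<bar>R\<bar> - \<bar>a\<bar>)"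
        using s[of u] s[of "-u"] by (simp_all add: a_def)
      with sp have "cosh (z + u) \<noteq> 0" "cosh (z - u) \<noteq> 0" by auto
      then have "norm (H z) = exp (- \<omega> * Im z) * (norm (sinh (2 * u)) / (norm (cosh (z + u)) * norm (cosh (z - u))))"
        unfolding H_def by (subst tanh_diff_eq) (auto simp: norm_mult norm_divide)
      also have "\<dots> \<le> 1 * (norm (sinh (2 * u)) / (sinh (\<bar>R\<bar> - \<bar>a\<bar>))\<^sup>2)"
        unfolding power2_eq_square using s12 sp w seg[OF z]
        by (intro mult_mono divide_left_mono mult_pos_pos) auto
      finally show "norm (H z) \<le> norm (sinh (2 * u)) / (sinh (\<bar>R\<bar> - \<bar>a\<bar>))\<^sup>2" by simp
    qed auto
    also have "norm (Complex R pi - of_real R) = pi"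
      by (simp add: Complex_eq norm_mult)
    finally show ?thesis .
  qed
  show "integral\<^sup>L lborel G = 2 * pi * sin (\<omega> * u) / of_real (sinh (pi * \<omega> / 2))"
  proof -
    have Vlim: "(\<lambda>n. V (s * real n)) \<longlonglongrightarrow> 0" if "\<bar>s\<bar> = 1" for s
    proof (rule Lim_null_comparison)
      have "\<forall>\<^sub>F n in sequentially. real n > \<bar>a\<bar>"
        by (rule eventually_sequentiallyI[of "nat \<lceil>\<bar>a\<bar>\<rceil> + 1"]) linarith
      then show "\<forall>\<^sub>F n in sequentially. norm (V (s * real n)) \<le> norm (sinh (2 * u)) / (sinh (real n - \<bar>a\<bar>))\<^sup>2 * pi"
        by eventually_elim (use Vb[of "s * real _"] that in \<open>simp add: abs_mult\<close>)
      show "(\<lambda>n. norm (sinh (2 * u)) / (sinh (real n - \<bar>a\<bar>))\<^sup>2 * pi) \<longlonglongrightarrow> 0"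
        by real_asymp
    qed
    have Ilim: "(\<lambda>n. integral {-real n..real n} G) \<longlonglongrightarrow> integral\<^sup>L lborel G"
    proof -
      have "(\<lambda>n. LINT x|lborel. indicator {-real n..real n} x *\<^sub>R G x) \<longlonglongrightarrow> integral\<^sup>L lborel G"
      proof (rule integral_dominated_convergence[where w = "\<lambda>x. norm (G x)"])
        show "AE x in lborel. (\<lambda>n. indicator {-real n..real n} x *\<^sub>R G x) \<longlonglongrightarrow> G x"
        proof (intro AE_I2 tendsto_eventually)
          fix x :: real
          show "\<forall>\<^sub>F n in sequentially. indicator {-real n..real n} x *\<^sub>R G x = G x"
          proof (rule eventually_sequentiallyI[of "nat \<lceil>\<bar>x\<bar>\<rceil>"])
            fix n assume "nat \<lceil>\<bar>x\<bar>\<rceil> \<le> n"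
            then have "- real n \<le> x" "x \<le> real n" by linarith+
            then show "indicator {-real n..real n} x *\<^sub>R G x = G x" by simp
          qed
        qed
      qed (use int mG in \<open>auto simp: indicator_def\<close>)
      moreover have "(LINT x|lborel. indicator {-real n..real n} x *\<^sub>R G x) = integral {-real n..real n} G" for n
        using set_borel_integral_eq_integral(2)[of "{-real n..real n}" G] int
        by (simp add: set_lebesgue_integral_def set_integrable_def integrable_mult_indicator)
      ultimately show ?thesis by simp
    qed
    have "(\<lambda>n. (1 - q) * integral {-real n..real n} G + V (real n) - V (- real n)) \<longlonglongrightarrow> (1 - q) * integral\<^sup>L lborel G + 0 - 0"
      using Vlim[of 1] Vlim[of "-1"] Ilim by (intro tendsto_intros) auto
    moreover have "\<forall>\<^sub>F n in sequentially. (1 - q) * integral {-real n..real n} G + V (real n) - V (- real n) = c"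
      by (rule eventually_sequentiallyI[of "nat \<lceil>\<bar>a\<bar>\<rceil> + 1"]) (rule rectH2[symmetric], linarith)
    ultimately have "(\<lambda>n. c) \<longlonglongrightarrow> (1 - q) * integral\<^sup>L lborel G + 0 - 0"
      by (rule Lim_transform_eventually)
    then have "c = (1 - q) * integral\<^sup>L lborel G"
      using LIMSEQ_unique[OF tendsto_const] by fastforce
    moreover have "c = 4 * pi * exp (- (pi * \<omega> / 2)) * sin (\<omega> * u)"
    proof -
      have "exp (\<i> * \<omega> * (\<i> * (pi/2) - u)) = exp (- (pi * \<omega> / 2)) * exp (- (\<i> * (\<omega> * u)))"
        "exp (\<i> * \<omega> * (\<i> * (pi/2) + u)) = exp (- (pi * \<omega> / 2)) * exp (\<i> * (\<omega> * u))"
        unfolding exp_of_real[symmetric] exp_add[symmetric] by (intro arg_cong[of _ _ exp]; simp add: algebra_simps)+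
      moreover have "sin (\<omega> * u) = - (\<i> / 2) * (exp (\<i> * (\<omega> * u)) - exp (- (\<i> * (\<omega> * u))))"
        unfolding sin_exp_eq by (simp add: field_simps)
      ultimately show ?thesis unfolding c_def by (simp only: mult_minus_left) (simp add: algebra_simps)
    qed
    moreover have "1 - q = 2 * exp (- (pi * \<omega> / 2)) * sinh (pi * \<omega> / 2)"
      by (simp add: q_def sinh_field_def algebra_simps flip: exp_add)
    ultimately have "2 * exp (- (pi * \<omega> / 2)) * (2 * pi * sin (\<omega> * u)) = 2 * exp (- (pi * \<omega> / 2)) * (sinh (pi * \<omega> / 2) * integral\<^sup>L lborel G)"
      by (simp add: algebra_simps)
    then have "2 * pi * sin (\<omega> * u) = sinh (pi * \<omega> / 2) * integral\<^sup>L lborel G"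
      by (subst (asm) mult_cancel_left) auto
    moreover have "sinh (pi * \<omega> / 2) \<noteq> 0" using w by simp
    ultimately show ?thesis by (simp add: field_simps)
  qed
qed

section \<open>Completeness of the sine system on the interval from 0 to pi\<close>

lemma integral_cos_multiple:
  "integral {0..pi} (\<lambda>u. cos (of_int k * u)) = (if k = 0 then pi else 0)"
proof (cases "k = 0")
  case False
  have "((\<lambda>u. cos (of_int k * u)) has_integral sin (of_int k * pi) / of_int k - sin (of_int k * 0) / of_int k) {0..pi}"
    using False by (intro fundamental_theorem_of_calculus)
      (auto intro!: derivative_eq_intros simp flip: has_real_derivative_iff_has_vector_derivative)
  moreover have "sin (of_int k * pi) = 0" using sin_zero_iff_int2 by blast
  ultimately show ?thesis using False by (simp add: integral_unique)
qed simp

lemma sine_orthogonality: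
  fixes m n :: nat
  assumes "n \<ge> 1"
  shows "integral {0..pi} (\<lambda>u. sin (real m * u) * sin (real n * u)) = (if m = n then pi/2 else 0)"
proof -
  have eq: "sin (real m * u) * sin (real n * u) =
      (cos (of_int (int m - int n) * u) - cos (of_int (int m + int n) * u)) / 2" for u
    by (simp add: sin_times_sin algebra_simps)
  have i: "(\<lambda>u. cos (of_int k * u)) integrable_on {0..pi}" for k
    by (intro integrable_continuous_real continuous_intros)
  show ?thesis unfolding eq using assms
    by (simp add: integral_diff[OF i i] integral_cos_multiple del: of_int_diff of_int_add)
qed

lemma sin_ge_linear:
  assumes "0 \<le> u" "u \<le> pi/2"
  shows "2 * u / pi \<le> sin u"
proof -
  have "convex_on {0..pi/2} (\<lambda>x. - sin x)"
    by (rule f''_ge0_imp_convex[where f' = "\<lambda>x. - cos x" and f'' = sin])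
       (auto intro!: derivative_eq_intros sin_ge_zero)
  from convex_onD[OF this, of "2 * u / pi" 0 "pi/2"] show ?thesis
    using assms by simp
qed

text \<open>Finite linear combinations of the functions \<open>u \<mapsto> sin (j u)\<close>. Closure under sums is built into the
  inductive definition, so that properties linear in the function follow by rule induction. The index
  \<open>j = 0\<close>, which gives the zero function, is harmless and avoids a case distinction.\<close>

inductive sine_poly :: "(real \<Rightarrow> real) \<Rightarrow> bool" where
  monomial: "sine_poly (\<lambda>u. c * sin (real j * u))"
| add: "sine_poly f \<Longrightarrow> sine_poly g \<Longrightarrow> sine_poly (\<lambda>u. f u + g u)"

lemma sine_poly_mult_const: "sine_poly f \<Longrightarrow> sine_poly (\<lambda>u. a * f u)"
proof (induction rule: sine_poly.induct)
  case (monomial c j)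
  then show ?case using sine_poly.monomial[of "a * c" j] by (simp add: mult.assoc)
next
  case (add f g)
  then show ?case using sine_poly.add[of "\<lambda>u. a * f u" "\<lambda>u. a * g u"] by (simp add: algebra_simps)
qed

lemma sine_poly_mult_cos: "sine_poly f \<Longrightarrow> sine_poly (\<lambda>u. cos u * f u)"
proof (induction rule: sine_poly.induct)
  case (monomial c j)
  show ?case
  proof (cases j)
    case 0
    then show ?thesis using sine_poly.monomial[of 0 0] by simp
  next
    case (Suc i)
    have "cos u * (c * sin (real j * u)) = c/2 * sin (real (Suc j) * u) + c/2 * sin (real i * u)" for u
    proof -
      have "sin (real (Suc j) * u) = sin (real j * u + u)" "sin (real i * u) = sin (real j * u - u)"
        by (simp_all add: Suc algebra_simps)
      then have "sin (real (Suc j) * u) + sin (real i * u) = 2 * (sin (real j * u) * cos u)"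
        unfolding sin_add sin_diff by linarith
      then show ?thesis unfolding distrib_left[symmetric] by (simp only:) simp
    qed
    then show ?thesis
      using sine_poly.add[OF sine_poly.monomial[of "c/2" "Suc j"] sine_poly.monomial[of "c/2" i]] by simp
  qed
next
  case (add f g)
  then show ?case using sine_poly.add[of "\<lambda>u. cos u * f u" "\<lambda>u. cos u * g u"] by (simp add: algebra_simps)
qed

lemma sine_poly_sum: "(\<And>i. i \<le> (n::nat) \<Longrightarrow> sine_poly (f i)) \<Longrightarrow> sine_poly (\<lambda>u. \<Sum>i\<le>n. f i u)"
  by (induction n) (auto intro: sine_poly.add)

lemma sine_poly_polynomial_cos:
  assumes "real_polynomial_function p"
  shows "sine_poly (\<lambda>u. p (cos u) * sin u)"
proof -
  obtain a n where p: "p = (\<lambda>x. \<Sum>i\<le>n. a i * x ^ i)"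
    using assms real_polynomial_function_iff_sum by blast
  have pow: "sine_poly (\<lambda>u. cos u ^ i * sin u)" for i
  proof (induction i)
    case 0
    then show ?case using sine_poly.monomial[of 1 1] by simp
  next
    case (Suc i)
    then show ?case using sine_poly_mult_cos[of "\<lambda>u. cos u ^ i * sin u"] by (simp add: mult.assoc)
  qed
  have "sine_poly (\<lambda>u. \<Sum>i\<le>n. a i * (cos u ^ i * sin u))"
    by (intro sine_poly_sum sine_poly_mult_const pow)
  then show ?thesis by (simp add: p sum_distrib_right mult.assoc)
qed

lemma continuous_on_sine_poly: "sine_poly f \<Longrightarrow> continuous_on S f"
  by (induction rule: sine_poly.induct) (intro continuous_intros; simp)+

text \<open>Sine polynomials are uniformly dense among the continuous functions bounded by a multiple of \<open>sin\<close>: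
  \<open>h\<close> is close to \<open>sin u \<cdot> r u\<close> with the continuous function \<open>r = h sin / (sin\<^sup>2 + d)\<close>, which stands in for
  \<open>h / sin\<close>, and \<open>r\<close> is approximated by a polynomial in \<open>cos u\<close>.\<close>

lemma sine_poly_dense:
  fixes h :: "real \<Rightarrow> real"
  assumes cont: "continuous_on {0..pi} h" and C: "C > 0" 
    and hb: "\<And>u. u \<in> {0..pi} \<Longrightarrow> \<bar>h u\<bar> \<le> C * sin u" and e: "e > 0"
  obtains p where "sine_poly p" "\<And>u. u \<in> {0..pi} \<Longrightarrow> \<bar>h u - p u\<bar> \<le> e"
proof -
  define d where "d = (e / C)\<^sup>2"
  have d: "d > 0" using e C by (simp add: d_def)
  have dpos: "(sin u)\<^sup>2 + d > 0" for u using d by (simp add: add_nonneg_pos)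
  define r where "r = (\<lambda>u. h u * sin u / ((sin u)\<^sup>2 + d))"
  have "continuous_on {-1..1} (\<lambda>t. r (arccos t))"
  proof (rule continuous_on_compose2[of "{0..pi}" r])
    show "continuous_on {0..pi} r" unfolding r_def
      using dpos by (intro continuous_intros cont) (auto simp: less_imp_neq[symmetric])
    show "continuous_on {-1..1} arccos" by (rule continuous_on_arccos')
  qed (auto simp: arccos_lbound arccos_ubound)
  then obtain p where p: "real_polynomial_function p"
      "\<And>t. t \<in> {-1..1} \<Longrightarrow> \<bar>r (arccos t) - p t\<bar> < e / 2"
    using Stone_Weierstrass_real_polynomial_function[of "{-1..1::real}" "\<lambda>t. r (arccos t)" "e / 2"] e by auto
  show ?thesis
  proof
    show "sine_poly (\<lambda>u. p (cos u) * sin u)" by (rule sine_poly_polynomial_cos[OF p(1)])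
    fix u assume u: "u \<in> {0..pi}"
    have s: "0 \<le> sin u" using u by (simp add: sin_ge_zero)
    have "\<bar>h u - r u * sin u\<bar> = \<bar>h u\<bar> * d / ((sin u)\<^sup>2 + d)"
    proof -
      have "h u - r u * sin u = h u * d / ((sin u)\<^sup>2 + d)"
        using dpos[of u] by (simp add: r_def field_simps power2_eq_square)
      then show ?thesis using dpos[of u] d by (simp add: abs_mult)
    qed
    also have "\<dots> \<le> e / 2"
    proof -
      \<comment> \<open>arithmetic-geometric mean inequality; d was chosen as the square of e/C for this step\<close>
      have "2 * (sin u * (e/C)) \<le> (sin u)\<^sup>2 + d"
        using sum_squares_bound[of "sin u" "e/C"] by (simp add: d_def mult.assoc)
      then have "2 * (sin u * (e/C)) * (e/C) \<le> ((sin u)\<^sup>2 + d) * (e/C)"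
        using e C by (intro mult_right_mono) auto
      then have "2 * (sin u * d) \<le> ((sin u)\<^sup>2 + d) * (e/C)"
        by (simp add: d_def power2_eq_square mult.assoc)
      then have "2 * (C * sin u * d) \<le> ((sin u)\<^sup>2 + d) * e"
        using C by (simp add: field_simps)
      moreover have "\<bar>h u\<bar> * d \<le> C * sin u * d"
        using hb[OF u] d by (intro mult_right_mono) auto
      ultimately have "2 * (\<bar>h u\<bar> * d) \<le> ((sin u)\<^sup>2 + d) * e" by linarith
      then show ?thesis using dpos[of u] by (simp add: field_simps)
    qed
    finally have 1: "\<bar>h u - r u * sin u\<bar> \<le> e / 2" .
    have "\<bar>r u - p (cos u)\<bar> < e / 2"
      using p(2)[of "cos u"] u by (simp add: arccos_cos)
    then have "\<bar>r u - p (cos u)\<bar> * \<bar>sin u\<bar> \<le> e / 2 * 1"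
      using e by (intro mult_mono) auto
    then have 2: "\<bar>r u * sin u - p (cos u) * sin u\<bar> \<le> e / 2"
      by (simp add: abs_mult[symmetric] left_diff_distrib)
    show "\<bar>h u - p (cos u) * sin u\<bar> \<le> e" using 1 2 by linarith
  qed
qed

text \<open>The inner product of \<open>L\<^sup>2(0, \<pi>)\<close>, used for continuous functions only.\<close>

definition ip :: "(real \<Rightarrow> real) \<Rightarrow> (real \<Rightarrow> real) \<Rightarrow> real" where
  "ip f g = integral {0..pi} (\<lambda>u. f u * g u)"

text \<open>The sine coefficients, without the normalising factor \<open>2/\<pi>\<close>.\<close>

definition sine_coeff :: "nat \<Rightarrow> (real \<Rightarrow> real) \<Rightarrow> real" where
  "sine_coeff n f = integral {0..pi} (\<lambda>u. f u * sin (real n * u))"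

lemma integrable_cont_mult:
  "continuous_on {0..pi} f \<Longrightarrow> continuous_on {0..pi} g \<Longrightarrow> (\<lambda>u. f u * g u :: real) integrable_on {0..pi}"
  by (intro integrable_continuous_real continuous_intros)

lemma ip_add_right: 
  "continuous_on {0..pi} f \<Longrightarrow> continuous_on {0..pi} g \<Longrightarrow> continuous_on {0..pi} h
    \<Longrightarrow> ip f (\<lambda>u. g u + h u) = ip f g + ip f h"
  unfolding ip_def distrib_left by (intro integral_add integrable_cont_mult)

lemma ip_diff_right: 
  "continuous_on {0..pi} f \<Longrightarrow> continuous_on {0..pi} g \<Longrightarrow> continuous_on {0..pi} h
    \<Longrightarrow> ip f (\<lambda>u. g u - h u) = ip f g - ip f h"
  unfolding ip_def right_diff_distrib by (intro integral_diff integrable_cont_mult)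

lemma sine_coeff_ip: "sine_coeff n f = ip f (\<lambda>u. sin (real n * u))"
  by (simp add: sine_coeff_def ip_def)

lemma ip_commute: "ip f g = ip g f" by (simp add: ip_def mult.commute)

lemma sine_partial_sum:
  assumes g: "continuous_on {0..pi} g"
  shows "ip g (\<lambda>u. \<Sum>n=1..N. b n * sin (real n * u)) = (\<Sum>n=1..N. b n * sine_coeff n g)"
proof -
  have "ip g (\<lambda>u. \<Sum>n=1..N. b n * sin (real n * u)) = integral {0..pi} (\<lambda>u. \<Sum>n=1..N. b n * (g u * sin (real n * u)))"
    unfolding ip_def by (simp add: sum_distrib_left algebra_simps)
  also have "\<dots> = (\<Sum>n=1..N. b n * sine_coeff n g)"
    unfolding sine_coeff_def
    by (subst integral_sum) (auto intro!: integrable_continuous_real continuous_intros g)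
  finally show ?thesis .
qed

lemma bessel_inequality:
  assumes e: "continuous_on {0..pi} e"
  shows "2/pi * (\<Sum>n=1..N. (sine_coeff n e)\<^sup>2) \<le> ip e e"
proof -
  define S where "S = (\<lambda>u. \<Sum>n=1..N. (2/pi * sine_coeff n e) * sin (real n * u))"
  have S: "continuous_on {0..pi} S" unfolding S_def by (intro continuous_intros)
  have D: "continuous_on {0..pi} (\<lambda>u. e u - S u)" by (intro continuous_intros e S)
  have eS: "ip e S = 2/pi * (\<Sum>n=1..N. (sine_coeff n e)\<^sup>2)"
    unfolding S_def sine_partial_sum[OF e] by (simp add: sum_distrib_left power2_eq_square mult.assoc)
  have cS: "sine_coeff m S = sine_coeff m e" if "m \<in> {1..N}" for m
  proof -
    have "sine_coeff m S = ip (\<lambda>u. sin (real m * u)) S" by (simp add: sine_coeff_ip ip_commute)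
    also have "\<dots> = (\<Sum>n=1..N. (2/pi * sine_coeff n e) * sine_coeff n (\<lambda>u. sin (real m * u)))"
      unfolding S_def by (rule sine_partial_sum) (intro continuous_intros)
    also have "\<dots> = (\<Sum>n=1..N. if n = m then sine_coeff m e else 0)"
      unfolding sine_coeff_def[of _ "\<lambda>u. sin (real m * u)"]
      by (intro sum.cong refl) (auto simp: sine_orthogonality)
    finally show ?thesis using that by simp
  qed
  have "ip S S = (\<Sum>n=1..N. (2/pi * sine_coeff n e) * sine_coeff n S)"
    by (subst (2) S_def) (rule sine_partial_sum[OF S])
  also have "\<dots> = (\<Sum>n=1..N. (2/pi * sine_coeff n e) * sine_coeff n e)"
    by (intro sum.cong refl) (simp only: cS)
  also have "\<dots> = ip e S"
    by (subst S_def) (rule sine_partial_sum[OF e, symmetric])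
  finally have "ip S S = ip e S" .
  moreover have "0 \<le> ip (\<lambda>u. e u - S u) (\<lambda>u. e u - S u)"
    unfolding ip_def by (intro integral_nonneg integrable_cont_mult D) auto
  moreover have "ip (\<lambda>u. e u - S u) (\<lambda>u. e u - S u) = ip e e - ip e S - (ip e S - ip S S)"
    unfolding ip_diff_right[OF D e S] ip_commute[of "\<lambda>u. e u - S u" e] ip_commute[of "\<lambda>u. e u - S u" S]
      ip_diff_right[OF e e S] ip_diff_right[OF S e S] ip_commute[of S e] by simp
  ultimately show ?thesis using eS by linarith
qed

lemma sine_poly_parseval:
  assumes "sine_poly p" and g: "continuous_on {0..pi} g"
  shows "\<exists>N0. \<forall>N\<ge>N0. ip g p = 2/pi * (\<Sum>n=1..N. sine_coeff n g * sine_coeff n p)"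
  using assms(1)
proof (induction rule: sine_poly.induct)
  case (monomial c j)
  show ?case
  proof (intro exI allI impI)
    fix N assume N: "N \<ge> j"
    have "sine_coeff n (\<lambda>u. c * sin (real j * u)) = c * (if j = n then pi/2 else 0)" if "n \<ge> 1" for n
      unfolding sine_coeff_def using sine_orthogonality[OF that, of j] by (simp add: mult.assoc)
    then have "(\<Sum>n=1..N. sine_coeff n g * sine_coeff n (\<lambda>u. c * sin (real j * u)))
        = (\<Sum>n=1..N. if n = j then sine_coeff j g * (c * (pi/2)) else 0)"
      by (intro sum.cong) auto
    also have "\<dots> = sine_coeff j g * (c * (pi/2))"
      using N by (cases "j = 0") (auto simp: sine_coeff_def)
    also have "\<dots> = pi/2 * ip g (\<lambda>u. c * sin (real j * u))"
      by (simp add: sine_coeff_def ip_def mult.left_commute)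
    finally have eq: "(\<Sum>n=1..N. sine_coeff n g * sine_coeff n (\<lambda>u. c * sin (real j * u)))
        = pi/2 * ip g (\<lambda>u. c * sin (real j * u))" .
    show "ip g (\<lambda>u. c * sin (real j * u)) = 2/pi * (\<Sum>n=1..N. sine_coeff n g * sine_coeff n (\<lambda>u. c * sin (real j * u)))"
      unfolding eq by simp
  qed
next
  case (add p q)
  have c: "continuous_on {0..pi} p" "continuous_on {0..pi} q" using add.hyps by (auto intro: continuous_on_sine_poly)
  obtain N1 N2 where
    "\<forall>N\<ge>N1. ip g p = 2/pi * (\<Sum>n=1..N. sine_coeff n g * sine_coeff n p)"
    "\<forall>N\<ge>N2. ip g q = 2/pi * (\<Sum>n=1..N. sine_coeff n g * sine_coeff n q)"
    using add.IH by blast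
  moreover have "sine_coeff n (\<lambda>u. p u + q u) = sine_coeff n p + sine_coeff n q" for n
    unfolding sine_coeff_def distrib_right by (intro integral_add integrable_cont_mult c continuous_intros)
  ultimately show ?case
    by (intro exI[of _ "max N1 N2"]) (auto simp: ip_add_right[OF g c] distrib_left sum.distrib)
qed

text \<open>Both \<open>\<langle>g, h\<rangle>\<close> and the partial sums of the series are bounded by a multiple of the supremum norm of
  \<open>h\<close>, the latter by Bessel's inequality. Hence the identity for sine polynomials extends to their
  uniform limits.\<close>

lemma sine_parseval_real:
  fixes g h :: "real \<Rightarrow> real"
  assumes g: "continuous_on {0..pi} g" and h: "continuous_on {0..pi} h" and C: "C > 0" 
    and hb: "\<And>u. u \<in> {0..pi} \<Longrightarrow> \<bar>h u\<bar> \<le> C * sin u"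
  shows "(\<lambda>k. sine_coeff (Suc k) g * sine_coeff (Suc k) h) sums (pi/2 * ip g h)"
proof -
  define K where "K = integral {0..pi} (\<lambda>u. \<bar>g u\<bar>) + sqrt (ip g g * pi)"
  have ipg: "ip g g \<ge> 0" unfolding ip_def by (intro integral_nonneg integrable_cont_mult g) auto
  have iag: "(\<lambda>u. \<bar>g u\<bar>) integrable_on {0..pi}" by (intro integrable_continuous_real continuous_intros g)
  have K: "K \<ge> 0" unfolding K_def by (intro add_nonneg_nonneg integral_nonneg iag) (auto intro!: mult_nonneg_nonneg ipg)
  define A where "A = (\<lambda>N f. 2/pi * (\<Sum>n=1..N. sine_coeff n g * sine_coeff n f))"
  \<comment> \<open>both functionals are bounded by the supremum norm, uniformly in the number of terms\<close>
  have bound: "\<bar>ip g f - A N f\<bar> \<le> e * K" if f: "continuous_on {0..pi} f" and fe: "\<And>u. u \<in> {0..pi} \<Longrightarrow> \<bar>f u\<bar> \<le> e" 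
    and e: "e > 0" for f e N
  proof -
    have "\<bar>ip g f\<bar> \<le> integral {0..pi} (\<lambda>u. e * \<bar>g u\<bar>)"
      unfolding ip_def real_norm_def[symmetric]
      by (rule integral_norm_bound_integral)
         (use fe in \<open>auto intro!: integrable_continuous_real continuous_intros g f mult_right_mono simp: abs_mult mult.commute[of "\<bar>g _\<bar>"]\<close>)
    then have 1: "\<bar>ip g f\<bar> \<le> e * integral {0..pi} (\<lambda>u. \<bar>g u\<bar>)" by simp
    have "ip f f \<le> integral {0..pi} (\<lambda>u. e\<^sup>2)"
      unfolding ip_def
    proof (rule integral_le[OF integrable_cont_mult[OF f f]])
      fix u assume "u \<in> {0..pi}"
      then have "\<bar>f u\<bar> \<le> \<bar>e\<bar>" using fe e by simp
      then show "f u * f u \<le> e\<^sup>2" by (simp add: abs_le_square_iff power2_eq_square)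
    qed auto
    then have ff: "ip f f \<le> e\<^sup>2 * pi" by (simp add: mult.commute)
    have "(A N f)\<^sup>2 = (2/pi)\<^sup>2 * (\<Sum>n=1..N. sine_coeff n g * sine_coeff n f)\<^sup>2"
      by (simp add: A_def power_mult_distrib power_divide)
    also have "\<dots> \<le> (2/pi)\<^sup>2 * ((\<Sum>n=1..N. (sine_coeff n g)\<^sup>2) * (\<Sum>n=1..N. (sine_coeff n f)\<^sup>2))"
      by (intro mult_left_mono Cauchy_Schwarz_ineq_sum) auto
    also have "\<dots> = (2/pi * (\<Sum>n=1..N. (sine_coeff n g)\<^sup>2)) * (2/pi * (\<Sum>n=1..N. (sine_coeff n f)\<^sup>2))"
      by (simp add: power2_eq_square)
    also have "\<dots> \<le> ip g g * (e\<^sup>2 * pi)"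
      by (rule mult_mono[OF bessel_inequality[OF g] order_trans[OF bessel_inequality[OF f] ff] ipg])
         (simp add: sum_nonneg)
    also have "\<dots> = (e * sqrt (ip g g * pi))\<^sup>2"
      using ipg pi_ge_zero by (simp add: power_mult_distrib)
    finally have "(A N f)\<^sup>2 \<le> (e * sqrt (ip g g * pi))\<^sup>2" .
    moreover have "0 \<le> ip g g * pi" using ipg by (intro mult_nonneg_nonneg) auto
    ultimately have 2: "\<bar>A N f\<bar> \<le> e * sqrt (ip g g * pi)"
      using e by (simp only: abs_le_square_iff[symmetric]) simp
    show ?thesis using 1 2 unfolding K_def distrib_left by linarith
  qed
  have "(\<lambda>N. A N h) \<longlonglongrightarrow> ip g h"
  proof (rule LIMSEQ_I)
    fix r :: real assume r: "r > 0"
    define e where "e = r / (K + 1)"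
    have e: "e > 0" "e * K < r" using r K by (auto simp: e_def field_simps)
    obtain p where p: "sine_poly p" "\<And>u. u \<in> {0..pi} \<Longrightarrow> \<bar>h u - p u\<bar> \<le> e"
      using sine_poly_dense[OF h C hb e(1)] by blast
    have cp: "continuous_on {0..pi} p" using p(1) by (rule continuous_on_sine_poly)
    obtain N0 where N0: "\<And>N. N \<ge> N0 \<Longrightarrow> ip g p = A N p"
      using sine_poly_parseval[OF p(1) g] unfolding A_def by blast
    have Ad: "A N (\<lambda>u. h u - p u) = A N h - A N p" for N
    proof -
      have "sine_coeff n (\<lambda>u. h u - p u) = sine_coeff n h - sine_coeff n p" for n
        unfolding sine_coeff_def left_diff_distrib by (intro integral_diff integrable_cont_mult cp h continuous_intros)
      then show ?thesis by (simp add: A_def right_diff_distrib sum_subtractf diff_divide_distrib)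
    qed
    show "\<exists>no. \<forall>n\<ge>no. norm (A n h - ip g h) < r"
    proof (intro exI allI impI)
      fix N assume N: "N \<ge> N0"
      have "\<bar>ip g (\<lambda>u. h u - p u) - A N (\<lambda>u. h u - p u)\<bar> \<le> e * K"
        using p(2) e(1) by (intro bound continuous_intros h cp) auto
      then show "norm (A N h - ip g h) < r"
        using e(2) N0[OF N] unfolding Ad ip_diff_right[OF g h cp] real_norm_def by linarith
    qed
  qed
  then have "(\<lambda>N. pi/2 * A N h) \<longlonglongrightarrow> pi/2 * ip g h" by (intro tendsto_intros)
  moreover have "pi/2 * A N h = (\<Sum>n<N. sine_coeff (Suc n) g * sine_coeff (Suc n) h)" for N
    by (simp add: A_def sum.atLeast1_atMost_eq)
  ultimately show ?thesis unfolding sums_def by simp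
qed

lemma sine_parseval:
  fixes g :: "real \<Rightarrow> real" and h :: "real \<Rightarrow> complex"
  assumes g: "continuous_on {0..pi} g" and h: "continuous_on {0..pi} h" and C: "C > 0" 
    and hb: "\<And>u. u \<in> {0..pi} \<Longrightarrow> norm (h u) \<le> C * sin u"
  shows "(\<lambda>k. of_real (integral {0..pi} (\<lambda>u. g u * sin (real (Suc k) * u))) *
               integral {0..pi} (\<lambda>u. of_real (sin (real (Suc k) * u)) * h u))
         sums (pi/2 * integral {0..pi} (\<lambda>u. of_real (g u) * h u))"
proof -
  have re: "Re (integral {0..pi} (\<lambda>u. of_real (f u) * h u)) = integral {0..pi} (\<lambda>u. f u * Re (h u))"
    and im: "Im (integral {0..pi} (\<lambda>u. of_real (f u) * h u)) = integral {0..pi} (\<lambda>u. f u * Im (h u))"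
    if f: "continuous_on {0..pi} f" for f
  proof -
    have i: "(\<lambda>u. of_real (f u) * h u) integrable_on {0..pi}"
      by (intro integrable_continuous_real continuous_intros f h)
    from integral_linear[OF i bounded_linear_Re] integral_linear[OF i bounded_linear_Im]
    show "Re (integral {0..pi} (\<lambda>u. of_real (f u) * h u)) = integral {0..pi} (\<lambda>u. f u * Re (h u))"
      "Im (integral {0..pi} (\<lambda>u. of_real (f u) * h u)) = integral {0..pi} (\<lambda>u. f u * Im (h u))"
      by (simp_all add: o_def)
  qed
  have s: "continuous_on {0..pi} (\<lambda>u. sin (real n * u))" for n by (intro continuous_intros)
  have "(\<lambda>k. sine_coeff (Suc k) g * sine_coeff (Suc k) (\<lambda>u. Re (h u))) sums (pi/2 * ip g (\<lambda>u. Re (h u)))"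
    "(\<lambda>k. sine_coeff (Suc k) g * sine_coeff (Suc k) (\<lambda>u. Im (h u))) sums (pi/2 * ip g (\<lambda>u. Im (h u)))"
    by (intro sine_parseval_real[OF g _ C] continuous_intros h
        order_trans[OF abs_Re_le_cmod hb] order_trans[OF abs_Im_le_cmod hb]; simp)+
  then show ?thesis
    unfolding sums_complex_iff using re[OF s, of "Suc _"] im[OF s, of "Suc _"] re[OF g] im[OF g]
    by (simp add: sine_coeff_def ip_def mult.commute del: of_nat_Suc)
qed

section \<open>The Macdonald function of imaginary order\<close>

lemma cosh_real_ge_square: "(1 + x\<^sup>2) / 2 \<le> cosh x" for x :: real
proof -
  have "cosh (2 * (x/2)) = 2 * (cosh (x/2))\<^sup>2 - 1"
    by (simp only: cosh_double cosh_square_eq) simp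
  then have "cosh x = 2 * (cosh (x/2))\<^sup>2 - 1" by simp
  moreover have "1 + (x/2)\<^sup>2 \<le> (cosh (x/2))\<^sup>2" by (rule cosh_real_ge)
  ultimately show ?thesis by (simp add: power_divide)
qed

lemma borel_measurable_cosh [measurable]: "(cosh :: real \<Rightarrow> real) \<in> borel_measurable borel"
  and borel_measurable_sinh [measurable]: "(sinh :: real \<Rightarrow> real) \<in> borel_measurable borel"
  by (intro borel_measurable_continuous_onI continuous_intros)+

lemma integrable_inverse_cosh: "integrable lborel (\<lambda>t::real. 1 / cosh t)"
proof (rule Bochner_Integration.integrable_bound[OF integrable_mult_right[OF integrable_inverse_1_plus_square', of 2]])
  show "AE t::real in lborel. norm (1 / cosh t) \<le> norm (2 * (1 / (1 + t\<^sup>2)))"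
  proof (intro AE_I2)
    fix t :: real
    have "1 / cosh t \<le> 1 / ((1 + t\<^sup>2) / 2)"
      using cosh_real_ge_square[of t] by (intro divide_left_mono mult_pos_pos) (auto intro: add_pos_nonneg)
    then show "norm (1 / cosh t) \<le> norm (2 * (1 / (1 + t\<^sup>2)))" by simp
  qed
qed measurable

lemma integrable_exp_cosh:
  assumes "y > (0::real)"
  shows "integrable lborel (\<lambda>t. exp (- (y * cosh t)))"
proof (rule Bochner_Integration.integrable_bound[OF integrable_mult_right[OF integrable_inverse_cosh, of "1 / y"]])
  show "AE t in lborel. norm (exp (- (y * cosh t))) \<le> norm (1 / y * (1 / cosh t))"
  proof (intro AE_I2)
    fix t :: real
    have p: "y * cosh t > 0" using assms by simp
    have "exp (- (y * cosh t)) = 1 / exp (y * cosh t)" by (simp add: exp_minus inverse_eq_divide)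
    also have "\<dots> \<le> 1 / (y * cosh t)"
      using p exp_ge_add_one_self[of "y * cosh t"] by (intro frac_le) linarith+
    finally show "norm (exp (- (y * cosh t))) \<le> norm (1 / y * (1 / cosh t))" using assms by simp
  qed
qed measurable

lemma integrable_exp_cosh_cos:
  assumes "y > (0::real)"
  shows "integrable lborel (\<lambda>t. exp (- (y * cosh t)) * cos (n * t))"
  by (rule Bochner_Integration.integrable_bound[OF integrable_exp_cosh[OF assms]])
     (auto intro!: AE_I2 simp: abs_mult mult_left_le)

lemma set_integral_half_line_even:
  fixes f :: "real \<Rightarrow> 'a::{banach, second_countable_topology}"
  assumes f: "integrable lborel f" and even: "\<And>x. f (- x) = f x"
  shows "(LBINT x:{0<..}. f x) = (1/2) *\<^sub>R integral\<^sup>L lborel f"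
proof -
  have i: "set_integrable lborel S f" if "S \<in> sets borel" for S
    using f that unfolding set_integrable_def by (simp add: integrable_mult_indicator)
  have "(LBINT x:{..<0}. f x) = (LBINT x:{0<..}. f x)"
    by (subst set_integral_reflect) (simp add: even greaterThan_def)
  moreover have "integral\<^sup>L lborel f = (LBINT x:{0<..} \<union> {..<0}. f x)"
    unfolding set_lebesgue_integral_def
  proof (rule integral_cong_AE)
    have "AE x in lborel. x \<noteq> (0::real)" by (rule AE_lborel_singleton)
    then show "AE x in lborel. f x = indicat_real ({0<..} \<union> {..<0}) x *\<^sub>R f x"
      by eventually_elim (auto simp: indicator_def)
  qed (use f in auto)
  moreover have "(LBINT x:{0<..} \<union> {..<0}. f x) = (LBINT x:{0<..}. f x) + (LBINT x:{..<0}. f x)"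
    by (intro set_integral_Un i) auto
  ultimately show ?thesis by (simp add: scaleR_2[symmetric])
qed

text \<open>The Macdonald function of the imaginary order \<open>i n\<close>, which is real, written as an integral over the
  whole line instead of the half-line; hence the factor \<open>1/2\<close>.\<close>

definition besselK :: "real \<Rightarrow> real \<Rightarrow> real" where
  "besselK n y = (LBINT t. exp (- (y * cosh t)) * cos (n * t)) / 2"

lemma macdonald_K_imaginary:
  assumes "y > 0"
  shows "macdonald_K (\<i> * of_real n) y = of_real (besselK n y)"
proof -
  have "cosh (\<i> * of_real n * of_real u) = of_real (cos (n * u))" for u
  proof -
    have "\<i> * (\<i> * of_real n * of_real u) = - of_real (n * u)" by (simp add: mult.assoc[symmetric])
    then show ?thesis by (simp only: cosh_conv_cos cos_minus cos_of_real)
  qed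
  then have "macdonald_K (\<i> * of_real n) y = (LBINT u:{0<..}. complex_of_real (exp (- (y * cosh u)) * cos (n * u)))"
    by (simp add: macdonald_K_def)
  also have "\<dots> = (LBINT u:{0<..}. exp (- (y * cosh u)) * cos (n * u))"
    by (rule set_integral_complex_of_real)
  also have "(LBINT u:{0<..}. exp (- (y * cosh u)) * cos (n * u)) = besselK n y"
    by (subst set_integral_half_line_even[OF integrable_exp_cosh_cos[OF assms]]) (simp_all add: besselK_def)
  finally show ?thesis .
qed

lemma borel_measurable_besselK [measurable]: "besselK n \<in> borel_measurable borel"
  unfolding besselK_def by measurable

lemma abs_besselK_le:
  assumes "y > 0" shows "\<bar>besselK n y\<bar> \<le> besselK 0 y"
proof -
  have "\<bar>LBINT t. exp (- (y * cosh t)) * cos (n * t)\<bar> \<le> (LBINT t. exp (- (y * cosh t)))"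
    by (rule order_trans[OF integral_abs_bound integral_mono])
       (use integrable_abs[OF integrable_exp_cosh_cos[OF assms, of n]] integrable_exp_cosh[OF assms] in
          \<open>auto simp: abs_mult mult_left_le\<close>)
  then show ?thesis by (simp add: besselK_def)
qed

lemma exp_integral_half_line:
  assumes "a > (0::real)"
  shows "set_integrable lborel {0<..} (\<lambda>y. exp (- (y * a)))" "(LBINT y:{0<..}. exp (- (y * a))) = 1 / a"
  using integrable_I0i_exp_mscale[OF assms] LBINT_I0i_exp_mscale[OF assms]
  by (simp_all add: interval_lebesgue_integral_0_infty)

text \<open>The integral representation of the Macdonald function may be integrated against any bounded
  function of \<open>y\<close>: the absolute double integral is at most the integral of \<open>1 / cosh\<close>.\<close>

lemma besselK_laplace:
  fixes d :: "real \<Rightarrow> real"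
  assumes [measurable]: "d \<in> borel_measurable borel" and d: "\<And>y. y > 0 \<Longrightarrow> \<bar>d y\<bar> \<le> 1"
  shows "set_integrable lborel {0<..} (\<lambda>y. besselK n y * d y)"
    and "(LBINT y:{0<..}. besselK n y * d y) =
         (LBINT t. cos (n * t) * (LBINT y:{0<..}. exp (- (y * cosh t)) * d y)) / 2"
proof -
  define P where "P = (\<lambda>t y. indicat_real {0<..} y * (exp (- (y * cosh t)) * cos (n * t) * d y))"
  have Pm [measurable]: "case_prod P \<in> borel_measurable (lborel \<Otimes>\<^sub>M lborel)"
    unfolding P_def by measurable
  have Pb: "\<bar>P t y\<bar> \<le> indicat_real {0<..} y * exp (- (y * cosh t))" for t y
  proof (cases "y > 0")
    case True
    have "\<bar>exp (- (y * cosh t)) * cos (n * t) * d y\<bar> \<le> exp (- (y * cosh t)) * 1 * 1"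
      unfolding abs_mult using d[OF True] by (intro mult_mono) auto
    then show ?thesis using True by (simp add: P_def)
  qed (simp add: P_def)
  have Ei: "integrable lborel (\<lambda>y. indicat_real {0<..} y * exp (- (y * cosh t)))" for t
    using exp_integral_half_line(1)[of "cosh t"] by (simp add: set_integrable_def)
  have Pi: "integrable lborel (P t)" for t
    by (rule Bochner_Integration.integrable_bound[OF Ei[of t]]) (use Pb in \<open>auto simp: P_def intro!: AE_I2\<close>)
  have PP: "integrable (lborel \<Otimes>\<^sub>M lborel) (case_prod P)"
  proof (rule lborel_pair.Fubini_integrable[OF Pm])
    show "integrable lborel (\<lambda>t. LBINT y. norm (case_prod P (t, y)))"
    proof (rule Bochner_Integration.integrable_bound[OF integrable_inverse_cosh])
      show "AE t in lborel. norm (LBINT y. norm (case_prod P (t, y))) \<le> norm (1 / cosh t)"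
      proof (intro AE_I2)
        fix t
        have "(LBINT y. norm (P t y)) \<le> (LBINT y. indicat_real {0<..} y * exp (- (y * cosh t)))"
          using Pi[of t] Ei[of t] Pb by (intro integral_mono) auto
        also have "\<dots> = 1 / cosh t"
          using exp_integral_half_line(2)[of "cosh t"] by (simp add: set_lebesgue_integral_def)
        finally show "norm (LBINT y. norm (case_prod P (t, y))) \<le> norm (1 / cosh t)" by simp
      qed
    qed measurable
  qed (use Pi in auto)
  have inner: "(LBINT t. P t y) = 2 * (indicat_real {0<..} y * (besselK n y * d y))" for y
  proof -
    have "(LBINT t. P t y) = (LBINT t. (indicat_real {0<..} y * d y) * (exp (- (y * cosh t)) * cos (n * t)))"
      unfolding P_def by (intro Bochner_Integration.integral_cong) auto
    also have "\<dots> = (indicat_real {0<..} y * d y) * (LBINT t. exp (- (y * cosh t)) * cos (n * t))"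
      by (rule integral_mult_right_zero)
    finally show ?thesis by (simp add: besselK_def)
  qed
  from lborel_pair.integrable_snd[OF PP] show "set_integrable lborel {0<..} (\<lambda>y. besselK n y * d y)"
    unfolding inner set_integrable_def by simp
  have "(LBINT t. LBINT y. P t y) = (LBINT y. LBINT t. P t y)"
    using lborel_pair.integral_fst[OF PP] lborel_pair.integral_snd[OF PP] by simp
  also have "\<dots> = 2 * (LBINT y:{0<..}. besselK n y * d y)"
    unfolding inner set_lebesgue_integral_def by simp
  finally have "(LBINT y:{0<..}. besselK n y * d y) = (LBINT t. LBINT y. P t y) / 2" by simp
  moreover have "(LBINT y. P t y) = cos (n * t) * (LBINT y:{0<..}. exp (- (y * cosh t)) * d y)" for t
  proof -
    have "(LBINT y. P t y) = (LBINT y. cos (n * t) * (indicat_real {0<..} y * (exp (- (y * cosh t)) * d y)))"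
      unfolding P_def by (intro Bochner_Integration.integral_cong) auto
    then show ?thesis by (simp add: set_lebesgue_integral_def)
  qed
  ultimately show "(LBINT y:{0<..}. besselK n y * d y) =
         (LBINT t. cos (n * t) * (LBINT y:{0<..}. exp (- (y * cosh t)) * d y)) / 2" by simp
qed

lemma set_integrable_besselK: "set_integrable lborel {0<..} (besselK n)"
  using besselK_laplace(1)[of "\<lambda>_. 1" n] by simp

section \<open>The sine transform of the Macdonald function\<close>

lemma laplace_sin:
  fixes a s :: real
  assumes a: "a > 0"
  shows "(LBINT y:{0<..}. exp (- (y * a)) * sin (y * s)) = s / (a\<^sup>2 + s\<^sup>2)"
proof -
  define F where "F = (\<lambda>y. - exp (- (y * a)) * (a * sin (y * s) + s * cos (y * s)) / (a\<^sup>2 + s\<^sup>2))"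
  have p: "a\<^sup>2 + s\<^sup>2 > 0" using a by (simp add: add_pos_nonneg)
  have "(LBINT y=0..\<infinity>. exp (- (y * a)) * sin (y * s)) = 0 - (- s / (a\<^sup>2 + s\<^sup>2))"
  proof (rule interval_integral_FTC_integrable[where F = F])
    fix y :: real
    have "((\<lambda>y. - exp (- (y * a)) * (a * sin (y * s) + s * cos (y * s))) has_real_derivative
        exp (- (y * a)) * sin (y * s) * (a\<^sup>2 + s\<^sup>2)) (at y)"
      by (auto intro!: derivative_eq_intros simp: algebra_simps power2_eq_square)
    from DERIV_cdivide[OF this, of "a\<^sup>2 + s\<^sup>2"]
    have "(F has_real_derivative exp (- (y * a)) * sin (y * s)) (at y)"
      unfolding F_def using a by simp
    then show "(F has_vector_derivative exp (- (y * a)) * sin (y * s)) (at y)"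
      by (simp add: has_real_derivative_iff_has_vector_derivative)
    show "isCont (\<lambda>y. exp (- (y * a)) * sin (y * s)) y" by (intro continuous_intros)
  next
    have "set_integrable lborel {0<..} (\<lambda>y. exp (- (y * a)) * sin (y * s))"
      by (rule set_integrable_bound[OF exp_integral_half_line(1)[OF a]])
         (auto simp: set_borel_measurable_def abs_mult mult_left_le)
    then show "set_integrable lborel (einterval 0 \<infinity>) (\<lambda>y. exp (- (y * a)) * sin (y * s))"
      by (simp add: zero_ereal_def)
  next
    have "isCont F 0" unfolding F_def using p by (intro continuous_intros) auto
    then have "(F \<longlongrightarrow> F 0) (at_right 0)"
      by (simp add: isCont_def filterlim_at_split)
    then show "((F \<circ> real_of_ereal) \<longlongrightarrow> - s / (a\<^sup>2 + s\<^sup>2)) (at_right 0)"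
      by (simp add: zero_ereal_def ereal_tendsto_simps F_def)
  next
    have "(F \<longlongrightarrow> 0) at_top"
    proof (rule Lim_null_comparison)
      show "\<forall>\<^sub>F y in at_top. norm (F y) \<le> exp (- (y * a)) * ((\<bar>a\<bar> + \<bar>s\<bar>) / (a\<^sup>2 + s\<^sup>2))"
      proof (intro always_eventually allI)
        fix y
        have "\<bar>a * sin (y * s) + s * cos (y * s)\<bar> \<le> \<bar>a\<bar> + \<bar>s\<bar>"
          by (rule order_trans[OF abs_triangle_ineq]) (auto simp: abs_mult intro!: add_mono mult_left_le)
        then have "exp (- (y * a)) * (\<bar>a * sin (y * s) + s * cos (y * s)\<bar> / (a\<^sup>2 + s\<^sup>2)) \<le> exp (- (y * a)) * ((\<bar>a\<bar> + \<bar>s\<bar>) / (a\<^sup>2 + s\<^sup>2))"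
          using p by (intro mult_left_mono divide_right_mono) auto
        then show "norm (F y) \<le> exp (- (y * a)) * ((\<bar>a\<bar> + \<bar>s\<bar>) / (a\<^sup>2 + s\<^sup>2))"
          using p by (simp add: F_def abs_mult)
      qed
      have "((\<lambda>y. exp (- (y * a))) \<longlongrightarrow> 0) at_top" using a by real_asymp
      then show "((\<lambda>y. exp (- (y * a)) * ((\<bar>a\<bar> + \<bar>s\<bar>) / (a\<^sup>2 + s\<^sup>2))) \<longlongrightarrow> 0) at_top"
        by (rule tendsto_mult_left_zero)
    qed
    then show "((F \<circ> real_of_ereal) \<longlongrightarrow> 0) (at_left \<infinity>)"
      by (simp add: ereal_tendsto_simps)
  qed auto
  then show ?thesis by (simp add: interval_lebesgue_integral_0_infty)
qed

lemma fourier_tanh_diff_real: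
  fixes u \<omega> :: real
  assumes "\<omega> > 0"
  shows "(LBINT t. cos (\<omega> * t) * (tanh (t + u) - tanh (t - u))) = 2 * pi * sin (\<omega> * u) / sinh (pi * \<omega> / 2)"
proof -
  let ?G = "\<lambda>t::real. exp (\<i> * \<omega> * t) * (tanh (t + of_real u) - tanh (t - of_real u))"
  have i: "integrable lborel ?G" and e: "integral\<^sup>L lborel ?G = 2 * of_real pi * sin (of_real \<omega> * complex_of_real u) / of_real (sinh (pi * \<omega> / 2))"
    by (rule fourier_tanh_diff(1), use assms in simp_all)
      (subst fourier_tanh_diff(2), use assms in simp_all)
  have "of_real (tanh x) = tanh (complex_of_real x)" for x
    by (simp add: tanh_def sinh_field_def cosh_field_def exp_of_real[symmetric])
  then have "?G t = cis (\<omega> * t) * of_real (tanh (t + u) - tanh (t - u))" for t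
    by (simp add: cis_conv_exp mult.assoc)
  then have "Re (?G t) = cos (\<omega> * t) * (tanh (t + u) - tanh (t - u))" for t by simp
  then have "(LBINT t. cos (\<omega> * t) * (tanh (t + u) - tanh (t - u))) = Re (integral\<^sup>L lborel ?G)"
    using integral_Re[OF i] by simp
  moreover have "sin (complex_of_real \<omega> * complex_of_real u) = complex_of_real (sin (\<omega> * u))"
    by (simp only: of_real_mult[symmetric] sin_of_real)
  then have "integral\<^sup>L lborel ?G = of_real (2 * pi * sin (\<omega> * u) / sinh (pi * \<omega> / 2))"
    unfolding e by simp
  ultimately show ?thesis by simp
qed

text \<open>Integrating first over \<open>y\<close> gives \<open>sinh u / (cosh\<^sup>2 t + sinh\<^sup>2 u)\<close>, which is a multiple of
  \<open>tanh (t + u) - tanh (t - u)\<close>.\<close>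

lemma besselK_sine_transform:
  assumes "n > 0"
  shows "(LBINT y:{0<..}. besselK n y * sin (y * sinh u)) = pi * sin (n * u) / (2 * sinh (pi * n / 2) * cosh u)"
proof -
  have eq: "(LBINT y:{0<..}. exp (- (y * cosh t)) * sin (y * sinh u)) = (tanh (t + u) - tanh (t - u)) / (2 * cosh u)" for t
  proof -
    note cosh_add_times_cosh_diff[of t u, symmetric]
    moreover have "tanh (t + u) - tanh (t - u) = 2 * sinh u * cosh u / (cosh (t + u) * cosh (t - u))"
    proof -
      have "2 * sinh u * cosh u = sinh ((t + u) - (t - u))" using sinh_double[of u] by simp
      also have "\<dots> = sinh (t + u) * cosh (t - u) - cosh (t + u) * sinh (t - u)"
        by (rule sinh_diff)
      finally show ?thesis
        by (simp add: tanh_def diff_frac_eq)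
    qed
    ultimately show ?thesis by (simp add: laplace_sin)
  qed
  have "(LBINT y:{0<..}. besselK n y * sin (y * sinh u)) =
      (LBINT t. cos (n * t) * ((tanh (t + u) - tanh (t - u)) / (2 * cosh u))) / 2"
    using besselK_laplace(2)[of "\<lambda>y. sin (y * sinh u)" n] by (simp add: eq)
  also have "\<dots> = (LBINT t. (cos (n * t) * (tanh (t + u) - tanh (t - u))) / (2 * cosh u)) / 2"
    by simp
  also have "\<dots> = (2 * pi * sin (n * u) / sinh (pi * n / 2)) / (2 * cosh u) / 2"
    unfolding integral_divide_zero fourier_tanh_diff_real[OF assms] ..
  finally show ?thesis by (simp add: field_simps)
qed

section \<open>The square norm of the Macdonald function\<close>

text \<open>For \<open>u = i\<pi>/4\<close> one has \<open>cosh (t + u) cosh (t - u) = cosh (2 t) / 2\<close>.\<close>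

lemma fourier_sech:
  assumes "\<nu> > (0::real)"
  shows "(LBINT p. cos (\<nu> * p) / cosh p) = pi / cosh (pi * \<nu> / 2)"
proof -
  define u where "u = \<i> * (pi / 4)"
  let ?G = "\<lambda>t::real. exp (\<i> * of_real (2 * \<nu>) * of_real t) * (tanh (of_real t + u) - tanh (of_real t - u))"
  have Imu: "\<bar>Im u\<bar> < pi/2" by (simp add: u_def)
  have i: "integrable lborel ?G"
    and e: "integral\<^sup>L lborel ?G = 2 * pi * sin (of_real (2 * \<nu>) * u) / of_real (sinh (pi * (2 * \<nu>) / 2))"
    using fourier_tanh_diff(1)[of u "2 * \<nu>"] fourier_tanh_diff(2)[of u "2 * \<nu>"] Imu assms by simp_all
  have G: "?G t = exp (\<i> * of_real (2 * \<nu>) * of_real t) * (2 * \<i> / of_real (cosh (2 * t)))" for t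
  proof -
    have cr: "cosh (complex_of_real x) = of_real (cosh x)" for x
      by (simp add: cosh_field_def exp_of_real[symmetric])
    have "cosh (of_real t + u) * cosh (of_real t - u) = (cosh (2 * of_real t) + cosh (2 * u)) / 2"
    proof -
      have "cosh (2 * of_real t) = cosh ((of_real t + u) + (of_real t - u))"
        "cosh (2 * u) = cosh ((of_real t + u) - (of_real t - u))" by simp_all
      then show ?thesis by (simp only: cosh_add cosh_diff) (simp add: algebra_simps)
    qed
    moreover have "cosh (2 * u) = 0" "sinh (2 * u) = \<i>"
    proof -
      have "\<i> * (2 * u) = - of_real (pi / 2)" by (simp add: u_def mult.assoc[symmetric])
      then show "cosh (2 * u) = 0" "sinh (2 * u) = \<i>"
        by (simp_all only: cosh_conv_cos sinh_conv_sin cos_minus sin_minus cos_of_real sin_of_real) simp_all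
    qed
    moreover have "cosh (2 * complex_of_real t) = of_real (cosh (2 * t))"
      using cr[of "2 * t"] by simp
    ultimately have c: "cosh (of_real t + u) * cosh (of_real t - u) = of_real (cosh (2 * t)) / 2" and s: "sinh (2 * u) = \<i>"
      by simp_all
    have "cosh (of_real t + u) \<noteq> 0" "cosh (of_real t - u) \<noteq> 0"
      using c by auto
    from tanh_diff_eq[OF this] show ?thesis unfolding c s by simp
  qed
  have ImG: "Im (?G t) = 2 * (cos (\<nu> * (0 + 2 * t)) / cosh (0 + 2 * t))" for t
  proof -
    have "exp (\<i> * of_real (2 * \<nu>) * of_real t) = cis (2 * \<nu> * t)"
      by (simp add: cis_conv_exp mult.assoc)
    then have "?G t = cis (2 * \<nu> * t) * (2 * \<i> / of_real (cosh (2 * t)))"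
      by (subst G) (simp only:)
    also have "\<dots> = (\<i> * cis (2 * \<nu> * t)) * of_real (2 / cosh (2 * t))" by simp
    finally have "Im (?G t) = cos (2 * \<nu> * t) * (2 / cosh (2 * t))" by simp
    then show ?thesis by (simp add: mult_ac)
  qed
  have "(LBINT p. cos (\<nu> * p) / cosh p) = \<bar>2\<bar> *\<^sub>R (LBINT t. cos (\<nu> * (0 + 2 * t)) / cosh (0 + 2 * t))"
    by (rule lborel_integral_real_affine) simp
  also have "\<dots> = (LBINT t. Im (?G t))"
    unfolding ImG integral_mult_right_zero by simp
  also have "\<dots> = Im (integral\<^sup>L lborel ?G)" by (rule integral_Im[OF i])
  also have "integral\<^sup>L lborel ?G = of_real (2 * pi * sinh (pi * \<nu> / 2) / sinh (pi * \<nu>)) * \<i>"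
  proof -
    have "of_real (2 * \<nu>) * u = \<i> * of_real (pi * \<nu> / 2)" by (simp add: u_def)
    then have "sin (of_real (2 * \<nu>) * u) = - \<i> * sinh (\<i> * (\<i> * of_real (pi * \<nu> / 2)))"
      by (simp only: sin_conv_sinh)
    also have "\<i> * (\<i> * of_real (pi * \<nu> / 2)) = - of_real (pi * \<nu> / 2)"
      by (simp add: mult.assoc[symmetric])
    also have "- \<i> * sinh (- complex_of_real (pi * \<nu> / 2)) = \<i> * sinh (of_real (pi * \<nu> / 2))"
      by (simp only: sinh_minus) simp
    also have "sinh (of_real (pi * \<nu> / 2)) = complex_of_real (sinh (pi * \<nu> / 2))"
      by (simp only: sinh_field_def exp_of_real[symmetric] of_real_minus[symmetric] of_real_diff of_real_divide) simp
    finally show ?thesis unfolding e by simp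
  qed
  also have "Im (of_real (2 * pi * sinh (pi * \<nu> / 2) / sinh (pi * \<nu>)) * \<i>) = pi / cosh (pi * \<nu> / 2)"
  proof -
    have "sinh (pi * \<nu>) = 2 * sinh (pi * \<nu> / 2) * cosh (pi * \<nu> / 2)" using sinh_double[of "pi * \<nu> / 2"] by simp
    moreover have "sinh (pi * \<nu> / 2) \<noteq> 0" using assms by simp
    ultimately show ?thesis by simp
  qed
  finally show ?thesis .
qed

lemma cosh_add_ge: "2 * (cosh (s/2) * cosh (t/2)) \<le> cosh s + cosh t" for s t :: real
proof -
  have c: "(cosh (x/2))\<^sup>2 \<le> cosh x" for x :: real
  proof -
    have "cosh (2 * (x/2)) = 2 * (cosh (x/2))\<^sup>2 - 1"
      by (simp only: cosh_double cosh_square_eq) simp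
    moreover have "1 \<le> (cosh (x/2))\<^sup>2" using cosh_real_ge_1[of "x/2"] by (simp add: one_le_power)
    ultimately show ?thesis by simp
  qed
  show ?thesis using sum_squares_bound[of "cosh (s/2)" "cosh (t/2)"] c[of s] c[of t] by linarith
qed

lemma integrable_inverse_cosh_half: "integrable lborel (\<lambda>t::real. 1 / cosh (t/2))"
  using lborel_integrable_real_affine[OF integrable_inverse_cosh, of "1/2" 0] by simp

lemma integrable_pair_mult:
  fixes f :: "real \<Rightarrow> real" and g :: "real \<Rightarrow> 'a::{real_normed_algebra, banach, second_countable_topology}"
  assumes f: "integrable lborel f" and g: "integrable lborel g"
  shows "integrable (lborel \<Otimes>\<^sub>M lborel) (\<lambda>(x, y). f x *\<^sub>R g y)"
proof (rule lborel_pair.Fubini_integrable)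
  show "(\<lambda>(x, y). f x *\<^sub>R g y) \<in> borel_measurable (lborel \<Otimes>\<^sub>M lborel)"
    using borel_measurable_integrable[OF f] borel_measurable_integrable[OF g] by measurable
  show "integrable lborel (\<lambda>x. LBINT y. norm (case (x, y) of (x, y) \<Rightarrow> f x *\<^sub>R g y))"
    using integrable_norm[OF f] by simp
  show "AE x in lborel. integrable lborel (\<lambda>y. case (x, y) of (x, y) \<Rightarrow> f x *\<^sub>R g y)"
    using g by simp
qed

text \<open>The substitution \<open>s = p + q\<close>, \<open>t = p - q\<close> factorises the kernel, since
  \<open>cosh s + cosh t = 2 cosh p cosh q\<close>.\<close>

lemma besselK_double_integral:
  assumes m: "m > (0::real)"
  shows "(LBINT t. LBINT s. cos (m * s) * cos (m * t) / (cosh s + cosh t)) =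
    pi / cosh (pi * m) * (LBINT p::real. 1 / cosh p)"
proof -
  define F where "F = (\<lambda>p q. (cos (2 * m * p) + cos (2 * m * q)) / (2 * cosh p * cosh q))"
  have Fm [measurable]: "case_prod F \<in> borel_measurable (lborel \<Otimes>\<^sub>M lborel)"
    unfolding F_def by measurable
  have Fb: "\<bar>F p q\<bar> \<le> 1 / cosh p * (1 / cosh q)" for p q
  proof -
    have "\<bar>cos (2 * m * p) + cos (2 * m * q)\<bar> \<le> 2"
      using abs_cos_le_one[of "2 * m * p"] abs_cos_le_one[of "2 * m * q"] by linarith
    then show ?thesis unfolding F_def by (simp add: abs_mult field_simps)
  qed
  have Fi: "integrable lborel (\<lambda>p. F p q)" for q
    by (rule Bochner_Integration.integrable_bound[OF integrable_mult_left[OF integrable_inverse_cosh, of "1 / cosh q"]])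
       (use Fb in \<open>auto simp: F_def intro!: AE_I2\<close>)
  have ci: "integrable lborel (\<lambda>p. cos (2 * m * p) / cosh p)"
    by (rule Bochner_Integration.integrable_bound[OF integrable_inverse_cosh])
       (auto intro!: AE_I2 divide_right_mono)
  have shift: "(LBINT t. h (t + q)) = (LBINT p. h p)" "integrable lborel h \<Longrightarrow> integrable lborel (\<lambda>t. h (t + q))"
    for h :: "real \<Rightarrow> real" and q
    using lborel_integral_real_affine[of 1 h q] lborel_integrable_real_affine[of h 1 q] by (simp_all add: add.commute)
  \<comment> \<open>the substitution is carried out one variable at a time: s = t + 2q for fixed t, then t = p - q for fixed q\<close>
  have fF: "cos (m * s) * cos (m * t) / (cosh s + cosh t) = F ((s + t) / 2) ((s - t) / 2) / 2" for s t
  proof -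
    have "cosh s = cosh ((s + t)/2 + (s - t)/2)" "cosh t = cosh ((s + t)/2 - (s - t)/2)"
      by (simp_all add: field_simps)
    then have "cosh s + cosh t = 2 * cosh ((s + t)/2) * cosh ((s - t)/2)"
      by (simp add: cosh_add cosh_diff)
    moreover have "cos (2 * m * ((s + t)/2)) + cos (2 * m * ((s - t)/2)) = 2 * (cos (m * s) * cos (m * t))"
    proof -
      have "2 * m * ((s + t)/2) = m * s + m * t" "2 * m * ((s - t)/2) = m * s - m * t"
        by (simp_all add: field_simps)
      then show ?thesis by (simp only: cos_add cos_diff)
    qed
    ultimately show ?thesis by (simp add: F_def)
  qed
  have "(LBINT s. cos (m * s) * cos (m * t) / (cosh s + cosh t)) = (LBINT s. F ((s + t) / 2) ((s - t) / 2)) / 2" for t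
    unfolding fF by (rule integral_divide_zero)
  moreover have "(LBINT s. F ((s + t) / 2) ((s - t) / 2)) = 2 * (LBINT q. F (t + q) q)" for t
  proof -
    have e: "((t + 2 * q) + t) / 2 = t + q" "((t + 2 * q) - t) / 2 = q" for q by simp_all
    from lborel_integral_real_affine[of 2 "\<lambda>s. F ((s + t) / 2) ((s - t) / 2)" t, unfolded e]
    show ?thesis by simp
  qed
  ultimately have "(LBINT t. LBINT s. cos (m * s) * cos (m * t) / (cosh s + cosh t)) = (LBINT t. LBINT q. F (t + q) q)"
    by simp
  also have "\<dots> = (LBINT q. LBINT t. F (t + q) q)"
  proof -
    have "integrable (lborel \<Otimes>\<^sub>M lborel) (\<lambda>(q, t). F (t + q) q)"
    proof (rule lborel_pair.Fubini_integrable)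
      show "(\<lambda>(q, t). F (t + q) q) \<in> borel_measurable (lborel \<Otimes>\<^sub>M lborel)"
        unfolding F_def by measurable
      have "integrable lborel (\<lambda>q. LBINT t. norm (F (t + q) q))"
      proof (rule Bochner_Integration.integrable_bound[OF integrable_mult_left[OF integrable_inverse_cosh, of "LBINT p::real. 1 / cosh p"]])
        show "(\<lambda>q. LBINT t. norm (F (t + q) q)) \<in> borel_measurable lborel"
          unfolding F_def by measurable
        show "AE q in lborel. norm (LBINT t. norm (F (t + q) q)) \<le> norm (1 / cosh q * (LBINT p::real. 1 / cosh p))"
        proof (intro AE_I2)
          fix q :: real
          have "(LBINT t. norm (F (t + q) q)) = (LBINT p. norm (F p q))"
            by (rule shift(1)[of "\<lambda>p. norm (F p q)"])
          also have "\<dots> \<le> (LBINT p. 1 / cosh p * (1 / cosh q))"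
            by (intro integral_mono integrable_norm Fi integrable_mult_left integrable_inverse_cosh)
               (use Fb in simp)
          also have "\<dots> = 1 / cosh q * (LBINT p::real. 1 / cosh p)"
            by (subst integral_mult_left_zero) simp
          finally show "norm (LBINT t. norm (F (t + q) q)) \<le> norm (1 / cosh q * (LBINT p::real. 1 / cosh p))"
            by simp
        qed
      qed
      then show "integrable lborel (\<lambda>q. LBINT t. norm (case (q, t) of (q, t) \<Rightarrow> F (t + q) q))" by simp
      show "AE q in lborel. integrable lborel (\<lambda>t. case (q, t) of (q, t) \<Rightarrow> F (t + q) q)"
        using shift(2)[OF Fi] by simp
    qed
    from lborel_pair.integral_snd[OF this] lborel_pair.integral_fst[OF this] show ?thesis by simp
  qed
  also have "\<dots> = (LBINT q. LBINT p. F p q)"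
    by (simp only: shift(1)[of "\<lambda>p. F p _"])
  also have "\<dots> = (LBINT q. (pi / cosh (pi * m)) / 2 * (1 / cosh q) + (LBINT p::real. 1 / cosh p) / 2 * (cos (2 * m * q) / cosh q))"
  proof (intro Bochner_Integration.integral_cong refl)
    fix q :: real
    have "F p q = (1 / (2 * cosh q)) * (cos (2 * m * p) / cosh p) + (cos (2 * m * q) / (2 * cosh q)) * (1 / cosh p)" for p
      by (simp add: F_def field_simps)
    then have "(LBINT p. F p q) = (1 / (2 * cosh q)) * (LBINT p. cos (2 * m * p) / cosh p) + (cos (2 * m * q) / (2 * cosh q)) * (LBINT p. 1 / cosh p)"
      using ci integrable_inverse_cosh by (simp del: times_divide_eq_left times_divide_eq_right)
    then show "(LBINT p. F p q) = (pi / cosh (pi * m)) / 2 * (1 / cosh q) + (LBINT p::real. 1 / cosh p) / 2 * (cos (2 * m * q) / cosh q)"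
      using fourier_sech[of "2 * m"] m by (simp add: mult_ac)
  qed
  also have "\<dots> = (LBINT q. (pi / cosh (pi * m)) / 2 * (1 / cosh q))
      + (LBINT q. (LBINT p::real. 1 / cosh p) / 2 * (cos (2 * m * q) / cosh q))"
    by (intro Bochner_Integration.integral_add integrable_mult_right ci integrable_inverse_cosh)
  also have "\<dots> = pi / cosh (pi * m) * (LBINT p::real. 1 / cosh p)"
    unfolding integral_mult_right_zero using fourier_sech[of "2 * m"] m by simp
  finally show ?thesis .
qed

text \<open>The square norm decays like \<open>e\<^bsup>-\<pi>m\<^esup>\<close>, hence the norm like \<open>e\<^bsup>-\<pi>m/2\<^esup>\<close>. The more elementary bound
  \<open>\<bar>K\<^bsub>i m\<^esub>(y)\<bar> \<le> e\<^bsup>-\<delta>m\<^esup> K\<^sub>0(y cos \<delta>)\<close>, obtained by shifting the path of integration, would cost a factor that is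
  logarithmic in \<open>m\<close>. The value \<open>\<pi>\<close> of the remaining integral is not needed.\<close>

lemma besselK_square_integral:
  assumes m: "m > (0::real)"
  shows "set_integrable lborel {0<..} (\<lambda>y. (besselK m y)\<^sup>2)"
    and "(LBINT y:{0<..}. (besselK m y)\<^sup>2) = pi * (LBINT p::real. 1 / cosh p) / (4 * cosh (pi * m))"
proof -
  have lap: "(LBINT y:{0<..}. besselK n y * exp (- (y * cosh t))) = (LBINT s. cos (n * s) / (cosh s + cosh t)) / 2" for n t
  proof -
    have "(LBINT y:{0<..}. exp (- (y * cosh s)) * exp (- (y * cosh t))) = 1 / (cosh s + cosh t)" for s
    proof -
      have "exp (- (y * cosh s)) * exp (- (y * cosh t)) = exp (- (y * (cosh s + cosh t)))" for y
        by (simp add: algebra_simps flip: exp_add)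
      then show ?thesis using exp_integral_half_line(2)[of "cosh s + cosh t"] by (simp add: add_pos_pos)
    qed
    then show ?thesis
      using besselK_laplace(2)[of "\<lambda>y. exp (- (y * cosh t))" n] by simp
  qed
  have lapi: "set_integrable lborel {0<..} (\<lambda>y. besselK n y * exp (- (y * cosh t)))" for n t
    by (rule besselK_laplace(1)) auto
  define Q where "Q = (\<lambda>t y. indicat_real {0<..} y * (besselK m y * exp (- (y * cosh t)) * cos (m * t)))"
  have Qm [measurable]: "case_prod Q \<in> borel_measurable (lborel \<Otimes>\<^sub>M lborel)"
    unfolding Q_def by measurable
  have Qb: "\<bar>Q t y\<bar> \<le> indicat_real {0<..} y * (besselK 0 y * exp (- (y * cosh t)))" for t y
  proof (cases "y > 0")
    case True
    have "\<bar>besselK m y * exp (- (y * cosh t)) * cos (m * t)\<bar> \<le> besselK 0 y * exp (- (y * cosh t)) * 1"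
      unfolding abs_mult using abs_besselK_le[OF True, of m] by (intro mult_mono) auto
    then show ?thesis using True by (simp add: Q_def)
  qed (simp add: Q_def)
  have Ei: "integrable lborel (\<lambda>y. indicat_real {0<..} y * (besselK 0 y * exp (- (y * cosh t))))" for t
    using lapi[of 0 t] by (simp add: set_integrable_def)
  have Qi: "integrable lborel (Q t)" for t
  proof (rule Bochner_Integration.integrable_bound[OF Ei[of t]])
    show "Q t \<in> borel_measurable lborel" unfolding Q_def by measurable
    show "AE y in lborel. norm (Q t y) \<le> norm (indicat_real {0<..} y * (besselK 0 y * exp (- (y * cosh t))))"
      unfolding real_norm_def by (intro AE_I2 order_trans[OF Qb abs_ge_self])
  qed
  have sumi: "integrable lborel (\<lambda>s. 1 / (cosh s + cosh t))" 
    and sumb: "(LBINT s. 1 / (cosh s + cosh t)) \<le> 1 / (2 * cosh (t/2)) * (LBINT s::real. 1 / cosh (s/2))" for t :: real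
  proof -
    have b: "1 / (cosh s + cosh t) \<le> 1 / (2 * cosh (t/2)) * (1 / cosh (s/2))" for s
    proof -
      have "1 / (cosh s + cosh t) \<le> 1 / (2 * (cosh (s/2) * cosh (t/2)))"
        by (rule divide_left_mono[OF cosh_add_ge]) (auto simp: add_pos_pos)
      then show ?thesis by (simp add: field_simps)
    qed
    show i: "integrable lborel (\<lambda>s. 1 / (cosh s + cosh t))"
      by (rule Bochner_Integration.integrable_bound[OF integrable_mult_right[OF integrable_inverse_cosh_half, of "1 / (2 * cosh (t/2))"]])
         (use b in \<open>auto intro!: AE_I2 simp: add_pos_pos abs_of_pos\<close>)
    have "(LBINT s. 1 / (cosh s + cosh t)) \<le> (LBINT s. 1 / (2 * cosh (t/2)) * (1 / cosh (s/2)))"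
      by (intro integral_mono i integrable_mult_right integrable_inverse_cosh_half b)
    then show "(LBINT s. 1 / (cosh s + cosh t)) \<le> 1 / (2 * cosh (t/2)) * (LBINT s::real. 1 / cosh (s/2))"
      by (simp only: integral_mult_right_zero)
  qed
  have QQ: "integrable (lborel \<Otimes>\<^sub>M lborel) (case_prod Q)"
  proof (rule lborel_pair.Fubini_integrable[OF Qm])
    show "integrable lborel (\<lambda>t. LBINT y. norm (case_prod Q (t, y)))"
    proof (rule Bochner_Integration.integrable_bound[OF integrable_mult_right[OF integrable_inverse_cosh_half, of "(LBINT s::real. 1 / cosh (s/2)) / 4"]])
      show "AE t in lborel. norm (LBINT y. norm (case_prod Q (t, y))) \<le> norm ((LBINT s::real. 1 / cosh (s/2)) / 4 * (1 / cosh (t/2)))"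
      proof (intro AE_I2)
        fix t
        have "(LBINT y. norm (Q t y)) \<le> (LBINT y. indicat_real {0<..} y * (besselK 0 y * exp (- (y * cosh t))))"
          using Qi[of t] Ei[of t] Qb by (intro integral_mono) auto
        also have "\<dots> = (LBINT s. 1 / (cosh s + cosh t)) / 2"
          using lap[of 0 t] by (simp add: set_lebesgue_integral_def)
        also have "\<dots> \<le> (LBINT s::real. 1 / cosh (s/2)) / 4 * (1 / cosh (t/2))"
          using sumb[of t] by (simp add: field_simps)
        finally have "(LBINT y. norm (Q t y)) \<le> (LBINT s::real. 1 / cosh (s/2)) / 4 * (1 / cosh (t/2))" .
        then show "norm (LBINT y. norm (case_prod Q (t, y))) \<le> norm ((LBINT s::real. 1 / cosh (s/2)) / 4 * (1 / cosh (t/2)))"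
          by simp
      qed
    qed measurable
  qed (use Qi in auto)
  have inner: "(LBINT t. Q t y) = 2 * (indicat_real {0<..} y * (besselK m y)\<^sup>2)" for y
  proof -
    have "(LBINT t. Q t y) = (LBINT t. (indicat_real {0<..} y * besselK m y) * (exp (- (y * cosh t)) * cos (m * t)))"
      unfolding Q_def by (intro Bochner_Integration.integral_cong) auto
    also have "\<dots> = (indicat_real {0<..} y * besselK m y) * (LBINT t. exp (- (y * cosh t)) * cos (m * t))"
      by (rule integral_mult_right_zero)
    finally show ?thesis by (simp add: besselK_def power2_eq_square)
  qed
  from lborel_pair.integrable_snd[OF QQ] show "set_integrable lborel {0<..} (\<lambda>y. (besselK m y)\<^sup>2)"
    unfolding inner set_integrable_def by simp
  have Qt: "(LBINT y. Q t y) = (LBINT s. cos (m * s) * cos (m * t) / (cosh s + cosh t)) / 2" for t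
  proof -
    have "(LBINT y. Q t y) = (LBINT y. cos (m * t) * (indicat_real {0<..} y * (besselK m y * exp (- (y * cosh t)))))"
      unfolding Q_def by (intro Bochner_Integration.integral_cong) auto
    also have "\<dots> = cos (m * t) * ((LBINT s. cos (m * s) / (cosh s + cosh t)) / 2)"
      using lap[of m t] by (simp add: set_lebesgue_integral_def)
    also have "\<dots> = (LBINT s. cos (m * t) * (cos (m * s) / (cosh s + cosh t))) / 2"
      unfolding integral_mult_right_zero by simp
    finally show ?thesis by (simp add: mult.commute)
  qed
  have "(LBINT t. LBINT y. Q t y) = pi / cosh (pi * m) * (LBINT p::real. 1 / cosh p) / 2"
    unfolding Qt integral_divide_zero besselK_double_integral[OF m] ..
  moreover have "(LBINT t. LBINT y. Q t y) = (LBINT y. LBINT t. Q t y)"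
    using lborel_pair.integral_fst[OF QQ] lborel_pair.integral_snd[OF QQ] by simp
  moreover have "(LBINT y. LBINT t. Q t y) = 2 * (LBINT y:{0<..}. (besselK m y)\<^sup>2)"
    unfolding inner set_lebesgue_integral_def by simp
  ultimately show "(LBINT y:{0<..}. (besselK m y)\<^sup>2) = pi * (LBINT p::real. 1 / cosh p) / (4 * cosh (pi * m))"
    by (simp add: field_simps)
qed

section \<open>Integrals against the Macdonald function\<close>

lemma set_integrable_continuous_Icc:
  fixes w :: "real \<Rightarrow> 'a::euclidean_space"
  assumes "continuous_on {a..b} w"
  shows "set_integrable lborel {a..b} w"
  using assms borel_integrable_atLeastAtMost'[of a b w] by simp

text \<open>The integral transform that represents \<open>f\<close>, reduced to the half interval. It is written as a gauge
  integral, but \<open>w\<close> is continuous in all uses.\<close>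

definition sinh_transform :: "(real \<Rightarrow> complex) \<Rightarrow> real \<Rightarrow> complex" where
  "sinh_transform w y = integral {0..pi} (\<lambda>u. of_real (sin (y * sinh u)) * w u)"

lemma sinh_transform_lborel:
  assumes "continuous_on {0..pi} w"
  shows "sinh_transform w y = (LBINT u. sin (y * sinh u) *\<^sub>R (indicat_real {0..pi} u *\<^sub>R w u))"
proof -
  have "set_integrable lborel {0..pi} (\<lambda>u. of_real (sin (y * sinh u)) * w u)"
    by (intro set_integrable_continuous_Icc continuous_intros assms)
  from set_borel_integral_eq_integral(2)[OF this]
  have "sinh_transform w y = (LBINT u:{0..pi}. of_real (sin (y * sinh u)) * w u)"
    by (simp add: sinh_transform_def)
  then show ?thesis
    by (simp add: set_lebesgue_integral_def scaleR_conv_of_real mult_ac)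
qed

lemma besselK_sinh_transform:
  assumes w: "continuous_on {0..pi} w" and n: "n > 0"
  shows "set_integrable lborel {0<..} (\<lambda>y. of_real (besselK n y) * sinh_transform w y)"
    and "(LBINT y:{0<..}. of_real (besselK n y) * sinh_transform w y) =
       of_real (pi / (2 * sinh (pi * n / 2))) * integral {0..pi} (\<lambda>u. of_real (sin (n * u) / cosh u) * w u)"
proof -
  define W where "W = (\<lambda>u. indicat_real {0..pi} u *\<^sub>R w u)"
  have W: "integrable lborel W"
    using set_integrable_continuous_Icc[OF w] by (simp add: set_integrable_def W_def)
  have Wm [measurable]: "W \<in> borel_measurable borel" using borel_measurable_integrable[OF W] by simp
  have K: "integrable lborel (\<lambda>y. indicat_real {0<..} y * besselK n y)"
    using set_integrable_besselK[of n] by (simp add: set_integrable_def)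
  define P where "P = (\<lambda>y u. (indicat_real {0<..} y * besselK n y * sin (y * sinh u)) *\<^sub>R W u)"
  have P: "integrable (lborel \<Otimes>\<^sub>M lborel) (case_prod P)"
  proof (rule Bochner_Integration.integrable_bound[OF integrable_pair_mult[OF K W]])
    show "case_prod P \<in> borel_measurable (lborel \<Otimes>\<^sub>M lborel)" unfolding P_def by measurable
    show "AE x in lborel \<Otimes>\<^sub>M lborel. norm (case_prod P x) \<le> norm (case x of (y, u) \<Rightarrow> (indicat_real {0<..} y * besselK n y) *\<^sub>R W u)"
    proof (intro AE_I2)
      fix x :: "real \<times> real"
      have "\<bar>indicat_real {0<..} y * besselK n y * sin (y * sinh u)\<bar> * norm (W u) \<le> \<bar>indicat_real {0<..} y * besselK n y\<bar> * norm (W u)" for y u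
        unfolding abs_mult by (intro mult_right_mono mult_left_le) auto
      then show "norm (case_prod P x) \<le> norm (case x of (y, u) \<Rightarrow> (indicat_real {0<..} y * besselK n y) *\<^sub>R W u)"
        by (cases x) (simp add: P_def)
    qed
  qed
  have in1: "(LBINT u. P y u) = indicat_real {0<..} y *\<^sub>R (of_real (besselK n y) * sinh_transform w y)" for y
  proof -
    have "(LBINT u. P y u) = (LBINT u. (indicat_real {0<..} y * besselK n y) *\<^sub>R (sin (y * sinh u) *\<^sub>R W u))"
      unfolding P_def by simp
    also have "\<dots> = (indicat_real {0<..} y * besselK n y) *\<^sub>R (LBINT u. sin (y * sinh u) *\<^sub>R W u)"
      by (rule integral_scaleR_right)
    finally show ?thesis by (simp add: sinh_transform_lborel[OF w] W_def scaleR_conv_of_real mult.assoc)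
  qed
  from lborel_pair.integrable_fst[OF P] show "set_integrable lborel {0<..} (\<lambda>y. of_real (besselK n y) * sinh_transform w y)"
    unfolding in1 set_integrable_def .
  have in2: "(LBINT y. P y u) = indicat_real {0..pi} u *\<^sub>R (of_real (pi / (2 * sinh (pi * n / 2))) * (of_real (sin (n * u) / cosh u) * w u))" for u
  proof -
    have "(LBINT y. P y u) = (LBINT y. indicat_real {0<..} y * (besselK n y * sin (y * sinh u))) *\<^sub>R W u"
    proof -
      have "integrable lborel (\<lambda>y. indicat_real {0<..} y * (besselK n y * sin (y * sinh u)))"
        using besselK_laplace(1)[of "\<lambda>y. sin (y * sinh u)" n] by (simp add: set_integrable_def)
      then show ?thesis unfolding P_def mult.assoc by (intro integral_scaleR_left)
    qed
    also have "(LBINT y. indicat_real {0<..} y * (besselK n y * sin (y * sinh u))) = pi * sin (n * u) / (2 * sinh (pi * n / 2) * cosh u)"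
      using besselK_sine_transform[OF n, of u] by (simp add: set_lebesgue_integral_def)
    finally show ?thesis by (simp add: W_def scaleR_conv_of_real)
  qed
  have "(LBINT y:{0<..}. of_real (besselK n y) * sinh_transform w y) = (LBINT y. LBINT u. P y u)"
    unfolding in1 set_lebesgue_integral_def ..
  also have "\<dots> = (LBINT u. LBINT y. P y u)"
    using lborel_pair.integral_fst[OF P] lborel_pair.integral_snd[OF P] by simp
  also have "\<dots> = (LBINT u:{0..pi}. of_real (pi / (2 * sinh (pi * n / 2))) * (of_real (sin (n * u) / cosh u) * w u))"
    unfolding in2 set_lebesgue_integral_def ..
  also have "\<dots> = integral {0..pi} (\<lambda>u. of_real (pi / (2 * sinh (pi * n / 2))) * (of_real (sin (n * u) / cosh u) * w u))"
    by (intro set_borel_integral_eq_integral(2) set_integrable_continuous_Icc continuous_intros w) auto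
  also have "\<dots> = of_real (pi / (2 * sinh (pi * n / 2))) * integral {0..pi} (\<lambda>u. of_real (sin (n * u) / cosh u) * w u)"
    by (rule integral_mult_right)
  finally show "(LBINT y:{0<..}. of_real (besselK n y) * sinh_transform w y) =
       of_real (pi / (2 * sinh (pi * n / 2))) * integral {0..pi} (\<lambda>u. of_real (sin (n * u) / cosh u) * w u)" .
qed

section \<open>The kernel of the second transform\<close>

text \<open>The unnormalised cosine coefficient of \<open>cos (x sinh u)\<close>, which is the integral in the definition of \<open>K\<^sub>c\<close>.\<close>

definition cos_sinh_coeff :: "nat \<Rightarrow> real \<Rightarrow> real" where
  "cos_sinh_coeff n x = integral {0..pi} (\<lambda>u. cos (x * sinh u) * cos (real n * u))"

text \<open>The unnormalised sine coefficient of \<open>sin (x sinh u) cosh u\<close>. Integration by parts relates it to the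
  cosine coefficient; it is this form that matches the sine transform of the Macdonald function.\<close>

definition sinh_kernel_coeff :: "nat \<Rightarrow> real \<Rightarrow> real" where
  "sinh_kernel_coeff n x = integral {0..pi} (\<lambda>u. (sin (x * sinh u) * cosh u) * sin (real n * u))"

lemma cos_sinh_coeff_by_parts: "real n * cos_sinh_coeff n x = x * sinh_kernel_coeff n x"
proof -
  have "((\<lambda>u. cos (x * sinh u) * (real n * cos (real n * u)) - x * ((sin (x * sinh u) * cosh u) * sin (real n * u)))
      has_integral (cos (x * sinh pi) * sin (real n * pi) - cos (x * sinh 0) * sin (real n * 0))) {0..pi}"
    by (intro fundamental_theorem_of_calculus)
       (auto intro!: derivative_eq_intros simp: algebra_simps simp flip: has_real_derivative_iff_has_vector_derivative)
  then have "integral {0..pi} (\<lambda>u. cos (x * sinh u) * (real n * cos (real n * u)) - x * ((sin (x * sinh u) * cosh u) * sin (real n * u))) = 0"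
    by (simp add: integral_unique)
  moreover have "integral {0..pi} (\<lambda>u. cos (x * sinh u) * (real n * cos (real n * u)) - x * ((sin (x * sinh u) * cosh u) * sin (real n * u)))
     = integral {0..pi} (\<lambda>u. real n * (cos (x * sinh u) * cos (real n * u))) - integral {0..pi} (\<lambda>u. x * ((sin (x * sinh u) * cosh u) * sin (real n * u)))"
    by (subst integral_diff) (auto intro!: integrable_continuous_real continuous_intros simp: mult_ac)
  ultimately show ?thesis by (simp add: cos_sinh_coeff_def sinh_kernel_coeff_def)
qed

lemma Kc_imaginary:
  assumes "n \<ge> 1"
  shows "Kc x (\<i> * of_nat n) pi = of_real (x / real n * sinh_kernel_coeff n x / cosh (pi * real n / 2))"
proof -
  have c1: "cosh (\<i> * of_nat n * of_real u) = of_real (cos (real n * u))" for u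
  proof -
    have "\<i> * (\<i> * of_nat n * of_real u) = - of_real (real n * u)" by (simp add: mult.assoc[symmetric])
    then show ?thesis by (simp only: cosh_conv_cos cos_minus cos_of_real)
  qed
  have c2: "cos (of_real pi * (\<i> * of_nat n) / 2) = complex_of_real (cosh (pi * real n / 2))"
  proof -
    have "complex_of_real pi * (\<i> * of_nat n) / 2 = \<i> * of_real (pi * real n / 2)" by simp
    then have "cos (of_real pi * (\<i> * of_nat n) / 2) = cosh (\<i> * (\<i> * of_real (pi * real n / 2)))"
      by (simp only: cos_conv_cosh)
    also have "\<dots> = cosh (complex_of_real (pi * real n / 2))"
      by (simp add: mult.assoc[symmetric] del: of_real_mult of_real_divide)
    finally show ?thesis
      by (simp only: cosh_field_def exp_of_real[symmetric] of_real_minus[symmetric] of_real_add of_real_divide) simp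
  qed
  have "(LBINT u=0..pi. of_real (cos (x * sinh u)) * cosh (\<i> * of_nat n * of_real u)) =
      (LBINT u=ereal 0..ereal pi. complex_of_real (cos (x * sinh u) * cos (real n * u)))"
    by (simp add: c1 zero_ereal_def)
  also have "\<dots> = complex_of_real (LBINT u=ereal 0..ereal pi. cos (x * sinh u) * cos (real n * u))"
    by (rule interval_lebesgue_integral_of_real)
  also have "(LBINT u=ereal 0..ereal pi. cos (x * sinh u) * cos (real n * u)) = cos_sinh_coeff n x"
    unfolding cos_sinh_coeff_def
    by (intro interval_integral_eq_integral set_integrable_continuous_Icc continuous_intros) auto
  also have "cos_sinh_coeff n x = x / real n * sinh_kernel_coeff n x"
    using cos_sinh_coeff_by_parts[of n x] assms by (simp add: field_simps)
  finally show ?thesis unfolding Kc_def c2 by simp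
qed

lemma macdonald_K_nat: "y > 0 \<Longrightarrow> macdonald_K (\<i> * of_nat n) y = of_real (besselK (real n) y)"
  using macdonald_K_imaginary[of y "real n"] by simp

lemma sinh_kernel_coeff_measurable [measurable]: "sinh_kernel_coeff n \<in> borel_measurable borel"
proof -
  have "sinh_kernel_coeff n = (\<lambda>x. LBINT u:{0..pi}. (sin (x * sinh u) * cosh u) * sin (real n * u))"
    unfolding sinh_kernel_coeff_def
    by (intro ext set_borel_integral_eq_integral(2)[symmetric] set_integrable_continuous_Icc continuous_intros)
  then show ?thesis unfolding set_lebesgue_integral_def by simp
qed

text \<open>The coefficient is bounded, and by the integration by parts so is its product with \<open>x\<close>.\<close>

lemma sinh_kernel_coeff_square_integrable: "set_integrable lborel {0<..} (\<lambda>x. (sinh_kernel_coeff n x)\<^sup>2)"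
proof -
  have b1: "\<bar>sinh_kernel_coeff n x\<bar> \<le> pi * cosh pi" for x
  proof -
    have "norm (sinh_kernel_coeff n x) \<le> integral {0..pi} (\<lambda>u. cosh pi)"
      unfolding sinh_kernel_coeff_def
    proof (rule integral_norm_bound_integral)
      show "norm ((sin (x * sinh u) * cosh u) * sin (real n * u)) \<le> cosh pi" if "u \<in> {0..pi}" for u
      proof -
        have "\<bar>sin (x * sinh u)\<bar> * cosh u * \<bar>sin (real n * u)\<bar> \<le> 1 * cosh pi * 1"
          using that by (intro mult_mono) (auto simp: cosh_real_nonneg_le_iff)
        then show ?thesis by (simp add: abs_mult)
      qed
    qed (auto intro!: integrable_continuous_real continuous_intros)
    then show ?thesis by simp
  qed
  have b2: "\<bar>x * sinh_kernel_coeff n x\<bar> \<le> real n * pi" for x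
  proof -
    have "norm (cos_sinh_coeff n x) \<le> integral {0..pi} (\<lambda>u. 1)"
      unfolding cos_sinh_coeff_def
    proof (rule integral_norm_bound_integral)
      show "norm (cos (x * sinh u) * cos (real n * u)) \<le> 1" for u
        unfolding real_norm_def abs_mult by (intro mult_le_one) auto
    qed (auto intro!: integrable_continuous_real continuous_intros)
    then have "real n * \<bar>cos_sinh_coeff n x\<bar> \<le> real n * pi" by (intro mult_left_mono) auto
    then show ?thesis by (simp add: cos_sinh_coeff_by_parts[symmetric] abs_mult)
  qed
  define B where "B = (pi * cosh pi)\<^sup>2 + (real n * pi)\<^sup>2"
  have bd: "(sinh_kernel_coeff n x)\<^sup>2 \<le> B * (1 / (1 + x\<^sup>2))" for x
  proof -
    have "(sinh_kernel_coeff n x)\<^sup>2 \<le> (pi * cosh pi)\<^sup>2" "(x * sinh_kernel_coeff n x)\<^sup>2 \<le> (real n * pi)\<^sup>2"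
      using b1[of x] b2[of x] by (simp_all add: abs_le_square_iff[symmetric])
    then have "(sinh_kernel_coeff n x)\<^sup>2 * (1 + x\<^sup>2) \<le> B"
      by (simp add: B_def algebra_simps power_mult_distrib)
    moreover have "1 + x\<^sup>2 > 0" by (simp add: add_pos_nonneg)
    ultimately show ?thesis by (simp add: field_simps)
  qed
  have B: "B \<ge> 0" by (simp add: B_def)
  have "integrable lborel (\<lambda>x. (sinh_kernel_coeff n x)\<^sup>2)"
    by (rule Bochner_Integration.integrable_bound[OF integrable_mult_right[OF integrable_inverse_1_plus_square', of B]])
       (use B in \<open>auto intro!: AE_I2 order_trans[OF bd] simp: abs_mult\<close>)
  then show ?thesis by (rule integrable_mult_indicator[of "{0<..}", unfolded set_integrable_def[symmetric], rotated]) simp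
qed

lemma AE_summable_norm:
  fixes f :: "nat \<Rightarrow> 'a \<Rightarrow> 'b::{banach, second_countable_topology}"
  assumes i: "\<And>k. integrable M (f k)" and s: "summable (\<lambda>k. \<integral>x. norm (f k x) \<partial>M)"
  shows "AE x in M. summable (\<lambda>k. norm (f k x))"
proof -
  have [measurable]: "f k \<in> borel_measurable M" for k using i by auto
  have "(\<integral>\<^sup>+x. (\<Sum>k. ennreal (norm (f k x))) \<partial>M) = (\<Sum>k. \<integral>\<^sup>+x. ennreal (norm (f k x)) \<partial>M)"
    by (rule nn_integral_suminf) measurable
  also have "\<dots> = (\<Sum>k. ennreal (\<integral>x. norm (f k x) \<partial>M))"
    by (intro suminf_cong nn_integral_eq_integral integrable_norm i) auto
  also have "\<dots> = ennreal (\<Sum>k. \<integral>x. norm (f k x) \<partial>M)"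
    by (rule suminf_ennreal_eq) (use s in \<open>auto simp: summable_sums\<close>)
  finally have "(\<integral>\<^sup>+x. (\<Sum>k. ennreal (norm (f k x))) \<partial>M) \<noteq> \<infinity>" by simp
  then have "AE x in M. (\<Sum>k. ennreal (norm (f k x))) \<noteq> \<infinity>"
    by (rule nn_integral_PInf_AE[rotated]) measurable
  then show ?thesis
    by eventually_elim (auto intro: summable_suminf_not_top)
qed

text \<open>The estimate behind the interchange of sum and integral. Instead of the Cauchy-Schwarz inequality,
  \<open>2 \<bar>x z\<bar> \<le> l z\<^sup>2 + x\<^sup>2 / l\<close> is integrated with \<open>l = e\<^bsup>-\<pi>m/2\<^esup>\<close>, the order of magnitude of the norm of the
  Macdonald function.\<close>

lemma besselK_sinh_kernel_integrable:
  assumes "m > (0::real)"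
  shows "set_integrable lborel {0<..} (\<lambda>y. besselK m y * sinh_kernel_coeff n y)"
    and "(LBINT y:{0<..}. \<bar>besselK m y * sinh_kernel_coeff n y\<bar>)
      \<le> exp (- pi * m / 2) * (((LBINT y:{0<..}. (sinh_kernel_coeff n y)\<^sup>2) + pi * (LBINT p::real. 1 / cosh p) / 2) / 2)"
proof -
  define l where "l = exp (- pi * m / 2)"
  have l: "l > 0" by (simp add: l_def)
  have b: "\<bar>x * z\<bar> \<le> (l * z\<^sup>2 + x\<^sup>2 / l) / 2" for x z :: real
  proof -
    have "0 \<le> (l * \<bar>z\<bar> - \<bar>x\<bar>)\<^sup>2" by simp
    also have "\<dots> = l\<^sup>2 * z\<^sup>2 + x\<^sup>2 - 2 * l * \<bar>x * z\<bar>"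
      by (simp add: power2_diff power_mult_distrib abs_mult algebra_simps)
    finally show ?thesis using l by (simp add: field_simps power2_eq_square)
  qed
  have iG: "integrable lborel (\<lambda>y. indicat_real {0<..} y * (sinh_kernel_coeff n y)\<^sup>2)"
    using sinh_kernel_coeff_square_integrable[of n] by (simp add: set_integrable_def)
  have iK: "integrable lborel (\<lambda>y. indicat_real {0<..} y * (besselK m y)\<^sup>2)"
    using besselK_square_integral(1)[OF assms] by (simp add: set_integrable_def)
  let ?R = "\<lambda>y. (l * (indicat_real {0<..} y * (sinh_kernel_coeff n y)\<^sup>2) + (indicat_real {0<..} y * (besselK m y)\<^sup>2) / l) / 2"
  have iR: "integrable lborel ?R" using iG iK by simp
  have bd: "\<bar>indicat_real {0<..} y * (besselK m y * sinh_kernel_coeff n y)\<bar> \<le> ?R y" for y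
    using b[of "besselK m y" "sinh_kernel_coeff n y"] by (simp add: indicator_def)
  have iKG: "integrable lborel (\<lambda>y. indicat_real {0<..} y * (besselK m y * sinh_kernel_coeff n y))"
  proof (rule Bochner_Integration.integrable_bound[OF iR])
    show "AE y in lborel. norm (indicat_real {0<..} y * (besselK m y * sinh_kernel_coeff n y)) \<le> norm (?R y)"
      unfolding real_norm_def by (intro AE_I2 order_trans[OF bd abs_ge_self])
  qed measurable
  then show "set_integrable lborel {0<..} (\<lambda>y. besselK m y * sinh_kernel_coeff n y)"
    by (simp add: set_integrable_def)
  have "(LBINT y:{0<..}. \<bar>besselK m y * sinh_kernel_coeff n y\<bar>) = (LBINT y. \<bar>indicat_real {0<..} y * (besselK m y * sinh_kernel_coeff n y)\<bar>)"
    unfolding set_lebesgue_integral_def by (intro Bochner_Integration.integral_cong) (auto simp: abs_mult)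
  also have "\<dots> \<le> (LBINT y. ?R y)"
    by (intro integral_mono integrable_abs iKG iR bd)
  also have "\<dots> = (l * (LBINT y:{0<..}. (sinh_kernel_coeff n y)\<^sup>2) + (LBINT y:{0<..}. (besselK m y)\<^sup>2) / l) / 2"
    using iG iK by (simp add: set_lebesgue_integral_def)
  also have "\<dots> \<le> (l * (LBINT y:{0<..}. (sinh_kernel_coeff n y)\<^sup>2) + (l * (pi * (LBINT p::real. 1 / cosh p) / 2))) / 2"
  proof -
    have S: "(LBINT p::real. 1 / cosh p) \<ge> 0" by (intro integral_nonneg_AE) auto
    \<comment> \<open>cosh (pi m) is at least half of exp (pi m)\<close>
    have "1 \<le> 2 * l\<^sup>2 * cosh (pi * m)"
    proof -
      have "2 * l\<^sup>2 * cosh (pi * m) = 1 + l\<^sup>2 * exp (- (pi * m))"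
        by (simp add: l_def cosh_field_def power2_eq_square algebra_simps flip: exp_add)
      then show ?thesis by simp
    qed
    then have "1 / (4 * cosh (pi * m)) \<le> l\<^sup>2 / 2"
      by (simp add: field_simps)
    then have "(pi * (LBINT p::real. 1 / cosh p)) * (1 / (4 * cosh (pi * m))) \<le> (pi * (LBINT p::real. 1 / cosh p)) * (l\<^sup>2 / 2)"
      using S by (intro mult_left_mono) auto
    then have "(LBINT y:{0<..}. (besselK m y)\<^sup>2) \<le> (pi * (LBINT p::real. 1 / cosh p)) * (l\<^sup>2 / 2)"
      unfolding besselK_square_integral(2)[OF assms] by simp
    then have "(LBINT y:{0<..}. (besselK m y)\<^sup>2) / l \<le> l * (pi * (LBINT p::real. 1 / cosh p) / 2)"
      using l by (simp add: field_simps power2_eq_square)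
    then show ?thesis by simp
  qed
  finally show "(LBINT y:{0<..}. \<bar>besselK m y * sinh_kernel_coeff n y\<bar>)
      \<le> exp (- pi * m / 2) * (((LBINT y:{0<..}. (sinh_kernel_coeff n y)\<^sup>2) + pi * (LBINT p::real. 1 / cosh p) / 2) / 2)"
    by (simp add: l_def distrib_left)
qed

lemma sinh_kernel_coeff_transform:
  "sinh_transform (\<lambda>u. of_real (cosh u * sin (real n * u))) y = of_real (sinh_kernel_coeff n y)"
proof -
  have "sinh_transform (\<lambda>u. of_real (cosh u * sin (real n * u))) y = integral {0..pi} (of_real \<circ> (\<lambda>u. (sin (y * sinh u) * cosh u) * sin (real n * u)))"
    by (simp add: sinh_transform_def o_def mult.assoc)
  also have "\<dots> = of_real (sinh_kernel_coeff n y)"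
    unfolding sinh_kernel_coeff_def
    by (rule integral_linear) (auto intro!: integrable_continuous_real continuous_intros bounded_linear_of_real)
  finally show ?thesis .
qed

lemma besselK_sinh_kernel_orthogonality:
  fixes m n :: nat
  assumes "m \<ge> 1" "n \<ge> 1"
  shows "(LBINT y:{0<..}. besselK (real m) y * sinh_kernel_coeff n y) =
    (if m = n then pi\<^sup>2 / (4 * sinh (pi * real n / 2)) else 0)"
proof -
  have "complex_of_real (LBINT y:{0<..}. besselK (real m) y * sinh_kernel_coeff n y) =
      (LBINT y:{0<..}. of_real (besselK (real m) y) * sinh_transform (\<lambda>u. of_real (cosh u * sin (real n * u))) y)"
    unfolding sinh_kernel_coeff_transform set_integral_complex_of_real[symmetric] by simp
  also have "\<dots> = of_real (pi / (2 * sinh (pi * real m / 2))) *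
      integral {0..pi} (\<lambda>u. of_real (sin (real m * u) / cosh u) * of_real (cosh u * sin (real n * u)))"
    using assms by (intro besselK_sinh_transform(2) continuous_intros) auto
  also have "integral {0..pi} (\<lambda>u. of_real (sin (real m * u) / cosh u) * of_real (cosh u * sin (real n * u))) =
     integral {0..pi} (complex_of_real \<circ> (\<lambda>u. sin (real m * u) * sin (real n * u)))"
    by (simp add: o_def)
  also have "\<dots> = of_real (integral {0..pi} (\<lambda>u. sin (real m * u) * sin (real n * u)))"
    by (rule integral_linear) (auto intro!: integrable_continuous_real continuous_intros bounded_linear_of_real)
  also have "\<dots> = of_real (if m = n then pi/2 else 0)"
    by (simp only: sine_orthogonality[OF assms(2)])
  finally have "complex_of_real (LBINT y:{0<..}. besselK (real m) y * sinh_kernel_coeff n y) =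
     of_real (pi / (2 * sinh (pi * real m / 2)) * (if m = n then pi/2 else 0))" by simp
  then show ?thesis by (simp only: of_real_eq_iff) (simp add: power2_eq_square)
qed

section \<open>The two expansions\<close>

lemma expansion_Kc:
  fixes f \<psi> :: "real \<Rightarrow> complex"
  assumes C: "C > 0" and per: "\<And>u. \<psi> (u + 2 * pi) = \<psi> u"
    and lip: "\<And>u v. u \<in> {-pi..pi} \<Longrightarrow> v \<in> {-pi..pi} \<Longrightarrow> norm (\<psi> u - \<psi> v) \<le> C * \<bar>u - v\<bar>"
    and f: "\<And>x. x > 0 \<Longrightarrow> f x = (LBINT u=-pi..pi. of_real (sin (x * sinh u)) * (\<psi> u * of_real (cosh u)))"
  shows "n \<ge> 1 \<Longrightarrow> set_integrable lborel {0<..} (\<lambda>y. macdonald_K (\<i> * of_nat n) y * f y)"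
    and "x > 0 \<Longrightarrow> (\<lambda>k. of_real (real (Suc k) * sinh (pi * real (Suc k))) * Kc x (\<i> * of_nat (Suc k)) pi
           * (LBINT y:{0<..}. macdonald_K (\<i> * of_nat (Suc k)) y * f y)) sums (of_real (x * pi\<^sup>2 / 2) * f x)"
proof -
  have cpsi: "continuous_on {-pi..pi} \<psi>"
  proof (rule Lipschitz.lipschitz_on_continuous_on)
    show "C-lipschitz_on {-pi..pi} \<psi>"
      using lip C by (intro lipschitz_onI) (auto simp: dist_norm)
  qed
  \<comment> \<open>only the odd part of psi contributes; by periodicity it vanishes at pi as well as at 0\<close>
  define h where "h = (\<lambda>u. \<psi> u - \<psi> (- u))"
  define w where "w = (\<lambda>u. of_real (cosh u) * h u)"
  have ch: "continuous_on {0..pi} h" unfolding h_def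
    by (intro continuous_intros continuous_on_compose2[OF cpsi]) auto
  have cw: "continuous_on {0..pi} w" unfolding w_def by (intro continuous_intros ch)
  have hb: "norm (h u) \<le> (C * pi) * sin u" if u: "u \<in> {0..pi}" for u
  proof (cases "u \<le> pi/2")
    case True
    have "norm (h u) \<le> C * \<bar>u - (-u)\<bar>" unfolding h_def using u by (intro lip) auto
    also have "\<dots> = (C * pi) * (2 * u / pi)" using u by simp
    also have "\<dots> \<le> (C * pi) * sin u"
      using True u C by (intro mult_left_mono sin_ge_linear) auto
    finally show ?thesis .
  next
    case False
    have "\<psi> (-pi) = \<psi> pi" using per[of "-pi"] by simp
    then have "h u = (\<psi> u - \<psi> pi) + (\<psi> (-pi) - \<psi> (-u))" by (simp add: h_def)
    then have "norm (h u) \<le> norm (\<psi> u - \<psi> pi) + norm (\<psi> (-pi) - \<psi> (-u))"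
      by (simp add: norm_triangle_ineq)
    also have "\<dots> \<le> C * \<bar>u - pi\<bar> + C * \<bar>(-pi) - (-u)\<bar>" using u by (intro add_mono lip) auto
    also have "\<dots> = (C * pi) * (2 * (pi - u) / pi)" using u by (simp add: field_simps)
    also have "\<dots> \<le> (C * pi) * sin (pi - u)"
      using False u C by (intro mult_left_mono sin_ge_linear) auto
    finally show ?thesis by simp
  qed
  have fw: "f x = sinh_transform w x" if x: "x > 0" for x
  proof -
    define g where "g = (\<lambda>u. of_real (sin (x * sinh u)) * (\<psi> u * of_real (cosh u)))"
    have cg: "continuous_on {-pi..pi} g" unfolding g_def by (intro continuous_intros cpsi)
    have ig: "g integrable_on {0..pi}" "(\<lambda>u. g (- u)) integrable_on {0..pi}"
      by (intro integrable_continuous_real continuous_on_subset[OF cg] continuous_on_compose2[OF cg]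
            continuous_intros; force)+
    have "f x = integral {-pi..pi} g"
      unfolding f[OF x] uminus_ereal.simps g_def[symmetric]
      by (rule interval_integral_eq_integral) (auto intro!: set_integrable_continuous_Icc cg)
    also have "\<dots> = integral {-pi..0} g + integral {0..pi} g"
      by (rule Henstock_Kurzweil_Integration.integral_combine[symmetric]) (auto intro!: integrable_continuous_real cg)
    also have "integral {-pi..0} g = integral {-pi..-0} (\<lambda>u. g (- (- u)))" by simp
    also have "\<dots> = integral {0..pi} (\<lambda>u. g (- u))"
      by (rule Henstock_Kurzweil_Integration.integral_reflect_real)
    also have "integral {0..pi} (\<lambda>u. g (- u)) + integral {0..pi} g = integral {0..pi} (\<lambda>u. g (- u) + g u)"
      by (rule integral_add[symmetric]) (rule ig)+
    also have "\<dots> = sinh_transform w x"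
      unfolding sinh_transform_def w_def h_def g_def by (intro integral_cong) (simp add: algebra_simps)
    finally show ?thesis .
  qed
  have Kf: "y \<in> {0<..} \<Longrightarrow> macdonald_K (\<i> * of_nat n) y * f y = of_real (besselK (real n) y) * sinh_transform w y" for n y
    by (simp only: macdonald_K_nat fw greaterThan_iff)
  show "set_integrable lborel {0<..} (\<lambda>y. macdonald_K (\<i> * of_nat n) y * f y)" if "n \<ge> 1" for n
  proof -
    have "set_integrable lborel {0<..} (\<lambda>y. of_real (besselK (real n) y) * sinh_transform w y)"
      using that by (intro besselK_sinh_transform(1) cw) auto
    then show ?thesis by (subst set_integrable_cong[OF refl refl Kf])
  qed
  have coeff: "(LBINT y:{0<..}. macdonald_K (\<i> * of_nat n) y * f y) =
      of_real (pi / (2 * sinh (pi * real n / 2))) * integral {0..pi} (\<lambda>u. of_real (sin (real n * u)) * h u)" if "n \<ge> 1" for n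
  proof -
    have "(LBINT y:{0<..}. macdonald_K (\<i> * of_nat n) y * f y) = (LBINT y:{0<..}. of_real (besselK (real n) y) * sinh_transform w y)"
      by (rule set_lebesgue_integral_cong) (auto simp: Kf)
    also have "\<dots> = of_real (pi / (2 * sinh (pi * real n / 2))) * integral {0..pi} (\<lambda>u. of_real (sin (real n * u) / cosh u) * w u)"
      using that by (intro besselK_sinh_transform(2) cw) auto
    finally show ?thesis by (simp add: w_def)
  qed
  assume x: "x > 0"
  let ?g = "\<lambda>u. sin (x * sinh u) * cosh u"
  have "(\<lambda>k. of_real (sinh_kernel_coeff (Suc k) x) * integral {0..pi} (\<lambda>u. of_real (sin (real (Suc k) * u)) * h u))
         sums (pi/2 * integral {0..pi} (\<lambda>u. of_real (?g u) * h u))"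
    unfolding sinh_kernel_coeff_def
    by (rule sine_parseval[OF _ ch _ hb]) (use C in \<open>auto intro!: continuous_intros\<close>)
  then have "(\<lambda>k. of_real (pi * x) * (of_real (sinh_kernel_coeff (Suc k) x) * integral {0..pi} (\<lambda>u. of_real (sin (real (Suc k) * u)) * h u)))
         sums (of_real (pi * x) * (pi/2 * integral {0..pi} (\<lambda>u. of_real (?g u) * h u)))"
    by (rule sums_mult)
  moreover have "integral {0..pi} (\<lambda>u. of_real (?g u) * h u) = f x"
    unfolding fw[OF x] sinh_transform_def w_def by (simp add: mult.assoc)
  moreover have "of_real (x * pi\<^sup>2 / 2) * f x = of_real (pi * x) * (pi/2 * f x)"
    by (simp add: power2_eq_square)
  moreover have "of_real (real n * sinh (pi * real n)) * Kc x (\<i> * of_nat n) pi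
      * (LBINT y:{0<..}. macdonald_K (\<i> * of_nat n) y * f y) =
      of_real (pi * x) * (of_real (sinh_kernel_coeff n x) * integral {0..pi} (\<lambda>u. of_real (sin (real n * u)) * h u))"
    if "n \<ge> 1" for n
  proof -
    have "sinh (pi * real n) = 2 * sinh (pi * real n / 2) * cosh (pi * real n / 2)" using sinh_double[of "pi * real n / 2"] by simp
    moreover have "sinh (pi * real n / 2) \<noteq> 0" using that by simp
    ultimately have "real n * sinh (pi * real n) * (x / real n * sinh_kernel_coeff n x / cosh (pi * real n / 2)) * (pi / (2 * sinh (pi * real n / 2)))
      = pi * x * sinh_kernel_coeff n x"
      using that by simp
    then show ?thesis unfolding Kc_imaginary[OF that] coeff[OF that]
      by (simp only: of_real_mult[symmetric] mult.assoc[symmetric])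
  qed
  ultimately show "(\<lambda>k. of_real (real (Suc k) * sinh (pi * real (Suc k))) * Kc x (\<i> * of_nat (Suc k)) pi
           * (LBINT y:{0<..}. macdonald_K (\<i> * of_nat (Suc k)) y * f y)) sums (of_real (x * pi\<^sup>2 / 2) * f x)"
    by (simp only: le_add1 plus_1_eq_Suc[symmetric])
qed

text \<open>The integral recovers the coefficient \<open>a n\<close>, so that the expansion of the theorem is the given one.\<close>

lemma expansion_macdonald:
  fixes f :: "real \<Rightarrow> complex" and a :: "nat \<Rightarrow> complex"
  assumes a: "summable (\<lambda>k. norm (a (Suc k)) * exp (- pi * real (Suc k) / 2))"
    and f: "\<And>x. x > 0 \<Longrightarrow> (\<lambda>k. a (Suc k) * macdonald_K (\<i> * of_nat (Suc k)) x) sums f x"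
    and n: "n \<ge> 1"
  shows "set_integrable lborel {0<..} (\<lambda>y. Kc y (\<i> * of_nat n) pi * f y / of_real y)"
    and "of_real (real n * sinh (pi * real n)) * (LBINT y:{0<..}. Kc y (\<i> * of_nat n) pi * f y / of_real y)
       = of_real (pi\<^sup>2 / 2) * a n"
proof -
  define g where "g = (\<lambda>k y. indicat_real {0<..} y *\<^sub>R (a (Suc k) * of_real (besselK (real (Suc k)) y * sinh_kernel_coeff n y)))"
  define c where "c = 1 / (real n * cosh (pi * real n / 2))"
  have gi: "integrable lborel (g k)" for k
  proof -
    have "set_integrable lborel {0<..} (\<lambda>y. a (Suc k) * of_real (besselK (real (Suc k)) y * sinh_kernel_coeff n y))"
    proof (rule set_integrable_mult_right)
      have "integrable lborel (\<lambda>y. complex_of_real (indicat_real {0<..} y *\<^sub>R (besselK (real (Suc k)) y * sinh_kernel_coeff n y)))"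
        using besselK_sinh_kernel_integrable(1)[of "real (Suc k)" n] unfolding set_integrable_def
        by (intro integrable_of_real) simp
      then show "set_integrable lborel {0<..} (\<lambda>y. complex_of_real (besselK (real (Suc k)) y * sinh_kernel_coeff n y))"
        by (simp add: set_integrable_def scaleR_conv_of_real)
    qed
    then show ?thesis by (simp add: g_def set_integrable_def)
  qed
  have gn: "(LBINT y. norm (g k y)) = norm (a (Suc k)) * (LBINT y:{0<..}. \<bar>besselK (real (Suc k)) y * sinh_kernel_coeff n y\<bar>)" for k
  proof -
    have "(LBINT y. norm (g k y)) = (LBINT y. norm (a (Suc k)) * (indicat_real {0<..} y * \<bar>besselK (real (Suc k)) y * sinh_kernel_coeff n y\<bar>))"
      by (intro Bochner_Integration.integral_cong) (auto simp: g_def norm_mult indicator_def simp del: of_real_mult of_nat_Suc)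
    then show ?thesis by (simp add: set_lebesgue_integral_def del: of_nat_Suc)
  qed
  have gs: "summable (\<lambda>k. LBINT y. norm (g k y))"
  proof (rule summable_comparison_test')
    let ?B = "((LBINT y:{0<..}. (sinh_kernel_coeff n y)\<^sup>2) + pi * (LBINT p::real. 1 / cosh p) / 2) / 2"
    show "summable (\<lambda>k. norm (a (Suc k)) * exp (- pi * real (Suc k) / 2) * ?B)"
      by (rule summable_mult2[OF a])
    show "norm (LBINT y. norm (g k y)) \<le> norm (a (Suc k)) * exp (- pi * real (Suc k) / 2) * ?B" if "k \<ge> 0" for k
    proof -
      have "(LBINT y. norm (g k y)) \<ge> 0" by simp
      moreover have "(LBINT y. norm (g k y)) \<le> norm (a (Suc k)) * (exp (- pi * real (Suc k) / 2) * ?B)"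
        unfolding gn by (intro mult_left_mono besselK_sinh_kernel_integrable(2)) auto
      ultimately show ?thesis by (simp add: mult.assoc)
    qed
  qed
  have AEs: "AE y in lborel. summable (\<lambda>k. norm (g k y))" by (rule AE_summable_norm[OF gi gs])
  have fy: "f y * sinh_kernel_coeff n y = (\<Sum>k. g k y)" if "y > 0" for y
  proof -
    have "(\<lambda>k. a (Suc k) * macdonald_K (\<i> * of_nat (Suc k)) y * of_real (sinh_kernel_coeff n y)) sums (f y * of_real (sinh_kernel_coeff n y))"
      by (intro sums_mult2 f that)
    moreover have "a (Suc k) * macdonald_K (\<i> * of_nat (Suc k)) y * of_real (sinh_kernel_coeff n y) = g k y" for k
      using that by (simp add: macdonald_K_nat g_def mult.assoc del: of_nat_Suc)
    ultimately show ?thesis by (simp add: sums_unique)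
  qed
  have eq: "indicat_real {0<..} y *\<^sub>R (Kc y (\<i> * of_nat n) pi * f y / of_real y) = of_real c * (\<Sum>k. g k y)" for y
  proof (cases "y > 0")
    case True
    have "Kc y (\<i> * of_nat n) pi * f y / of_real y = of_real c * (f y * sinh_kernel_coeff n y)"
      unfolding Kc_imaginary[OF n] using True by (simp add: c_def field_simps)
    then show ?thesis using True fy[OF True] by simp
  next
    case False
    then show ?thesis by (simp add: g_def)
  qed
  show "set_integrable lborel {0<..} (\<lambda>y. Kc y (\<i> * of_nat n) pi * f y / of_real y)"
    unfolding set_integrable_def eq using integrable_suminf[OF gi AEs gs] by simp
  have gI: "(LBINT y. g k y) = (if Suc k = n then a n * of_real (pi\<^sup>2 / (4 * sinh (pi * real n / 2))) else 0)" for k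
  proof -
    have "(LBINT y. g k y) = (LBINT y:{0<..}. a (Suc k) * of_real (besselK (real (Suc k)) y * sinh_kernel_coeff n y))"
      unfolding g_def set_lebesgue_integral_def ..
    also have "\<dots> = a (Suc k) * (LBINT y:{0<..}. complex_of_real (besselK (real (Suc k)) y * sinh_kernel_coeff n y))"
      by (simp only: set_integral_mult_right)
    also have "\<dots> = a (Suc k) * of_real (if Suc k = n then pi\<^sup>2 / (4 * sinh (pi * real n / 2)) else 0)"
      unfolding set_integral_complex_of_real using n by (subst besselK_sinh_kernel_orthogonality) auto
    finally show ?thesis by simp
  qed
  have "(LBINT y:{0<..}. Kc y (\<i> * of_nat n) pi * f y / of_real y) = of_real c * (\<Sum>k. LBINT y. g k y)"
    unfolding set_lebesgue_integral_def eq using integral_suminf[OF gi AEs gs] by simp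
  also have "(\<Sum>k. LBINT y. g k y) = (\<Sum>k. if k = n - 1 then a n * of_real (pi\<^sup>2 / (4 * sinh (pi * real n / 2))) else 0)"
    unfolding gI using n by (intro suminf_cong) auto
  also have "\<dots> = a n * of_real (pi\<^sup>2 / (4 * sinh (pi * real n / 2)))"
    using sums_single[of "n - 1" "\<lambda>_. a n * of_real (pi\<^sup>2 / (4 * sinh (pi * real n / 2)))"] by (simp add: sums_iff)
  finally have I: "(LBINT y:{0<..}. Kc y (\<i> * of_nat n) pi * f y / of_real y) = of_real c * (a n * of_real (pi\<^sup>2 / (4 * sinh (pi * real n / 2))))" .
  have "sinh (pi * real n) = 2 * sinh (pi * real n / 2) * cosh (pi * real n / 2)" using sinh_double[of "pi * real n / 2"] by simp
  moreover have "sinh (pi * real n / 2) \<noteq> 0" using n by simp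
  ultimately have "real n * sinh (pi * real n) * c * (pi\<^sup>2 / (4 * sinh (pi * real n / 2))) = pi\<^sup>2 / 2"
    using n by (simp add: c_def)
  then have eq2: "complex_of_real (real n * sinh (pi * real n) * c * (pi\<^sup>2 / (4 * sinh (pi * real n / 2)))) = of_real (pi\<^sup>2 / 2)"
    by (simp only:)
  have "of_real (s * t) * (of_real c * (z * of_real p)) = of_real (s * t * c * p) * z" for s t p and z :: complex
    by (simp add: mult_ac)
  then show "of_real (real n * sinh (pi * real n)) * (LBINT y:{0<..}. Kc y (\<i> * of_nat n) pi * f y / of_real y)
       = of_real (pi\<^sup>2 / 2) * a n"
    unfolding I by (simp only: eq2)
qed

theorem theorem6:
  fixes f :: "real \<Rightarrow> complex"
  shows
    "(\<forall>(\<psi> :: real \<Rightarrow> complex) (\<phi> :: real \<Rightarrow> complex) (C :: real).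
        C > 0 \<and>
        (\<forall>u. \<psi> (u + 2 * pi) = \<psi> u) \<and>
        (\<forall>u \<in> {-pi..pi}. \<forall>v \<in> {-pi..pi}. norm (\<psi> u - \<psi> v) \<le> C * \<bar>u - v\<bar>) \<and>
        (\<forall>u. \<phi> u = \<psi> u * of_real (cosh u)) \<and>
        (\<forall>x>0. f x = (LBINT u=-pi..pi. of_real (sin (x * sinh u)) * \<phi> u))
        \<longrightarrow>
        (\<forall>n\<ge>1. set_integrable lborel {0<..}
                 (\<lambda>y. macdonald_K (\<i> * of_nat n) y * f y)) \<and>
        (\<forall>x>0.
           (let term = (\<lambda>n::nat. of_real (real n * sinh (pi * real n))
                          * Kc x (\<i> * of_nat n) pi
                          * (LBINT y:{0<..}. macdonald_K (\<i> * of_nat n) y * f y))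
            in summable (\<lambda>k. term (Suc k)) \<and>
               f x = of_real (2 / (x * pi\<^sup>2)) * (\<Sum>k. term (Suc k)))))
     \<and>
     (\<forall>a :: nat \<Rightarrow> complex.
        summable (\<lambda>k. norm (a (Suc k)) * exp (- pi * real (Suc k) / 2)) \<and>
        (\<forall>x>0. (\<lambda>k. a (Suc k) * macdonald_K (\<i> * of_nat (Suc k)) x) sums f x)
        \<longrightarrow>
        (\<forall>n\<ge>1. set_integrable lborel {0<..}
                 (\<lambda>y. Kc y (\<i> * of_nat n) pi * f y / of_real y)) \<and>
        (\<forall>x>0.
           (let term = (\<lambda>n::nat. of_real (real n * sinh (pi * real n))
                          * macdonald_K (\<i> * of_nat n) x
                          * (LBINT y:{0<..}. Kc y (\<i> * of_nat n) pi * f y / of_real y))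
            in summable (\<lambda>k. term (Suc k)) \<and>
               f x = of_real (2 / pi\<^sup>2) * (\<Sum>k. term (Suc k)))))"
proof (intro conjI allI impI; (elim conjE)?; (intro conjI allI impI)?)
  fix \<psi> \<phi> :: "real \<Rightarrow> complex" and C :: real
  assume C: "C > 0" and per: "\<forall>u. \<psi> (u + 2 * pi) = \<psi> u"
    and lip: "\<forall>u \<in> {-pi..pi}. \<forall>v \<in> {-pi..pi}. norm (\<psi> u - \<psi> v) \<le> C * \<bar>u - v\<bar>"
    and \<phi>: "\<forall>u. \<phi> u = \<psi> u * of_real (cosh u)"
    and f: "\<forall>x>0. f x = (LBINT u=-pi..pi. of_real (sin (x * sinh u)) * \<phi> u)"
  have f': "f x = (LBINT u=-pi..pi. of_real (sin (x * sinh u)) * (\<psi> u * of_real (cosh u)))" if "x > 0" for x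
    using f that by (simp only: \<phi>)
  note E = expansion_Kc[of C \<psi> f, OF C _ _ f']
  show "set_integrable lborel {0<..} (\<lambda>y. macdonald_K (\<i> * of_nat n) y * f y)" if "n \<ge> 1" for n
    using E(1)[of n] per lip that by blast
  fix x :: real
  assume x: "x > 0"
  define T where "T = (\<lambda>n::nat. of_real (real n * sinh (pi * real n)) * Kc x (\<i> * of_nat n) pi
                          * (LBINT y:{0<..}. macdonald_K (\<i> * of_nat n) y * f y))"
  have S: "(\<lambda>k. T (Suc k)) sums (of_real (x * pi\<^sup>2 / 2) * f x)"
    unfolding T_def using E(2)[of x] per lip x by blast
  have "f x = of_real (2 / (x * pi\<^sup>2)) * (of_real (x * pi\<^sup>2 / 2) * f x)"
    using x by (simp flip: of_real_mult mult.assoc)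
  then show "let term = (\<lambda>n::nat. of_real (real n * sinh (pi * real n))
                          * Kc x (\<i> * of_nat n) pi
                          * (LBINT y:{0<..}. macdonald_K (\<i> * of_nat n) y * f y))
            in summable (\<lambda>k. term (Suc k)) \<and>
               f x = of_real (2 / (x * pi\<^sup>2)) * (\<Sum>k. term (Suc k))"
    unfolding T_def[symmetric] Let_def using S by (metis sums_iff)
next
  fix a :: "nat \<Rightarrow> complex"
  assume a: "summable (\<lambda>k. norm (a (Suc k)) * exp (- pi * real (Suc k) / 2))"
    and f: "\<forall>x>0. (\<lambda>k. a (Suc k) * macdonald_K (\<i> * of_nat (Suc k)) x) sums f x"
  note E = expansion_macdonald[OF a f[rule_format]]
  show "set_integrable lborel {0<..} (\<lambda>y. Kc y (\<i> * of_nat n) pi * f y / of_real y)" if "n \<ge> 1" for n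
    using E(1)[OF _ that] by blast
  fix x :: real
  assume x: "x > 0"
  define T where "T = (\<lambda>n::nat. of_real (real n * sinh (pi * real n)) * macdonald_K (\<i> * of_nat n) x
                          * (LBINT y:{0<..}. Kc y (\<i> * of_nat n) pi * f y / of_real y))"
  have T: "T n = of_real (pi\<^sup>2 / 2) * (a n * macdonald_K (\<i> * of_nat n) x)" if "n \<ge> 1" for n
    using E(2)[OF _ that] unfolding T_def by (simp add: mult_ac)
  have S: "(\<lambda>k. T (Suc k)) sums (of_real (pi\<^sup>2 / 2) * f x)"
    by (subst T, simp) (rule sums_mult[OF f[rule_format, OF x]])
  have "f x = of_real (2 / pi\<^sup>2) * (of_real (pi\<^sup>2 / 2) * f x)"
    by (simp flip: of_real_mult mult.assoc)
  then show "let term = (\<lambda>n::nat. of_real (real n * sinh (pi * real n))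
                          * macdonald_K (\<i> * of_nat n) x
                          * (LBINT y:{0<..}. Kc y (\<i> * of_nat n) pi * f y / of_real y))
            in summable (\<lambda>k. term (Suc k)) \<and>
               f x = of_real (2 / pi\<^sup>2) * (\<Sum>k. term (Suc k))"
    unfolding T_def[symmetric] Let_def using S by (metis sums_iff)
qed

end
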